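(* Let $\Gamma$ be a groupoid, $R$ a unital $\Gamma$-graded ring and $\overline{\Sigma}=(\Sigma_i)_{i\in I}\in\mathcal{P}(\Gamma)^I$ a fully matricial sequence for $R$. If $R$ is a right gr-artinian ring, then $\mathrm{M}_I(R)(\overline{\Sigma})$ is a right $\Gamma_0$-artinian ring and $\mathrm{rad}^{\mathrm{gr}}\big(\mathrm{M}_I(R)(\overline{\Sigma})\big)$ is nilpotent.
   Context: A groupoid $\Gamma$ is the set of morphisms of a small category in which all morphisms are invertible; $\Gamma_0\subseteq\Gamma$ is the set of identity morphisms; $d(\gamma)=\gamma^{-1}\gamma$, $r(\gamma)=\gamma\gamma^{-1}$; the product $\gamma\delta$ is defined iff $d(\gamma)=r(\delta)$. For $\Sigma,\Sigma'\subseteq\Gamma$, $\Sigma\Sigma'$ is the set of all defined products and $\Sigma^{-1}$ the set of inverses. Rings are associative, not necessarily unital. A $\Gamma$-graded ring is a ring $R=\bigoplus_{\gamma\in\Gamma}R_\gamma$ (additive subgroups) with $R_\gamma R_\delta\subseteq R_{\gamma\delta}$ if $d(\gamma)=r(\delta)$ and $R_\gamma R_\delta=0$ otherwise; it is always assumed object unital: for each $e\in\Gamma_0$ the ring $R_e$ has an identity $1_e$ (possibly $0$) with $1_{r(\gamma)}a=a=a1_{d(\gamma)}$ for all $a\in R_\gamma$, $\gamma\in\Gamma$. Put $\Gamma_0'(R)=\{e\in\Gamma_0: 1_e\ne0\}$. One- or two-sided ideals $U$ are graded if $U=\bigoplus_\gamma (U\cap R_\gamma)$. $R$ is right gr-artinian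 if it has no infinite strictly decreasing chain of graded right ideals; a $\Gamma$-graded ring $S$ is right $\Gamma_0$-artinian if for every $e\in\Gamma_0$ there is no infinite strictly decreasing chain of graded right ideals contained in $1_eS$. $\mathrm{rad}^{\mathrm{gr}}(S)$ is the intersection of all gr-maximal graded right ideals of $S$ (those maximal among proper graded right ideals); it is a graded two-sided ideal. An ideal $U$ is nilpotent if $U^n=0$ for some positive integer $n$. A family $\overline\Sigma=(\Sigma_i)_{i\in I}$ of nonempty subsets of $\Gamma$ is fully matricial for $R$ if: (1) for each $e\in\Gamma_0$ the set $\{i\in I: d(\sigma)=e\text{ for some }\sigma\in\Sigma_i\}$ is finite; (2) for each $i\in I$ the map $\Sigma_i\to\Gamma_0$, $\sigma\mapsto d(\sigma)$, is injective; (3) for each $i\in I$, $\sigma\mapsto r(\sigma)$ is a bijection $\Sigma_i\to\Gamma_0'(R)$. Then $\Sigma_i\gamma\Sigma_j^{-1}$ has at most one element for all $i,j\in I$, $\gamma\in\Gamma$. $\mathrm{M}_I(R)(\overline\Sigma)$ denotes the ring $\mathrm{M}_I(R)$ of $I\times I$ matrices over $R$ with finitely many nonzero entries, $\Gamma$-graded by $$\mathrm{M}_I(R)(\overline\Sigma)_\gamma=\{(a_{ij})_{ij}: a_{ij}\in R_{\Sigma_i\gamma\Sigma_j^{-1}}\ \text{for all } i,j\},$$ where $R_{\emptyset}=0$ and $R_{\{\delta\}}=R_\delta$; this is an (object unital) $\Gamma$-graded ring. *)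

theory Defs
  imports Main
begin

section \<open>Groupoids\<close>

text \<open>
  A small category is given by its set of morphisms; an object is identified with its identity
  morphism, so domain and range of a morphism are again morphisms. The value of
  \<open>cmp \<Gamma> x y\<close> is meaningful only if \<open>dm \<Gamma> x = rg \<Gamma> y\<close>.
\<close>

record 'g small_cat =
  Mor :: "'g set"
  dm :: "'g \<Rightarrow> 'g"
  rg :: "'g \<Rightarrow> 'g"
  cmp :: "'g \<Rightarrow> 'g \<Rightarrow> 'g"

definition small_category :: "('g, 'm) small_cat_scheme \<Rightarrow> bool" where
  "small_category \<Gamma> \<longleftrightarrow>
    (\<forall>x\<in>Mor \<Gamma>. dm \<Gamma> x \<in> Mor \<Gamma> \<and> rg \<Gamma> x \<in> Mor \<Gamma> \<and>
       dm \<Gamma> (dm \<Gamma> x) = dm \<Gamma> x \<and> rg \<Gamma> (dm \<Gamma> x) = dm \<Gamma> x \<and>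
       dm \<Gamma> (rg \<Gamma> x) = rg \<Gamma> x \<and> rg \<Gamma> (rg \<Gamma> x) = rg \<Gamma> x \<and>
       cmp \<Gamma> x (dm \<Gamma> x) = x \<and> cmp \<Gamma> (rg \<Gamma> x) x = x) \<and>
    (\<forall>x\<in>Mor \<Gamma>. \<forall>y\<in>Mor \<Gamma>. dm \<Gamma> x = rg \<Gamma> y \<longrightarrow>
       cmp \<Gamma> x y \<in> Mor \<Gamma> \<and> dm \<Gamma> (cmp \<Gamma> x y) = dm \<Gamma> y \<and> rg \<Gamma> (cmp \<Gamma> x y) = rg \<Gamma> x) \<and>
    (\<forall>x\<in>Mor \<Gamma>. \<forall>y\<in>Mor \<Gamma>. \<forall>z\<in>Mor \<Gamma>. dm \<Gamma> x = rg \<Gamma> y \<longrightarrow> dm \<Gamma> y = rg \<Gamma> z \<longrightarrow>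
       cmp \<Gamma> (cmp \<Gamma> x y) z = cmp \<Gamma> x (cmp \<Gamma> y z))"

definition is_inverse :: "('g, 'm) small_cat_scheme \<Rightarrow> 'g \<Rightarrow> 'g \<Rightarrow> bool" where
  "is_inverse \<Gamma> x y \<longleftrightarrow> y \<in> Mor \<Gamma> \<and> dm \<Gamma> y = rg \<Gamma> x \<and> rg \<Gamma> y = dm \<Gamma> x \<and>
     cmp \<Gamma> y x = dm \<Gamma> x \<and> cmp \<Gamma> x y = rg \<Gamma> x"

definition groupoid :: "('g, 'm) small_cat_scheme \<Rightarrow> bool" where
  "groupoid \<Gamma> \<longleftrightarrow> small_category \<Gamma> \<and> (\<forall>x\<in>Mor \<Gamma>. \<exists>y. is_inverse \<Gamma> x y)"

definition inv_mor :: "('g, 'm) small_cat_scheme \<Rightarrow> 'g \<Rightarrow> 'g" where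
  "inv_mor \<Gamma> x = (THE y. is_inverse \<Gamma> x y)"

definition Idm :: "('g, 'm) small_cat_scheme \<Rightarrow> 'g set" where
  "Idm \<Gamma> = {e \<in> Mor \<Gamma>. dm \<Gamma> e = e}"

definition cmp_set :: "('g, 'm) small_cat_scheme \<Rightarrow> 'g set \<Rightarrow> 'g set \<Rightarrow> 'g set" where
  "cmp_set \<Gamma> A B = {cmp \<Gamma> x y | x y. x \<in> A \<and> y \<in> B \<and> dm \<Gamma> x = rg \<Gamma> y}"

definition inv_set :: "('g, 'm) small_cat_scheme \<Rightarrow> 'g set \<Rightarrow> 'g set" where
  "inv_set \<Gamma> A = inv_mor \<Gamma> ` A"


section \<open>Graded rings\<close>

text \<open>
  The type class \<^class>\<open>ring\<close> does not require a unit. A ring is a subring \<open>S\<close> of a type of this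
  class, so that it may be zero and may be a ring of matrices over a given index set.
\<close>

definition add_subgroup :: "'a::ring set \<Rightarrow> bool" where
  "add_subgroup H \<longleftrightarrow> 0 \<in> H \<and> (\<forall>x\<in>H. \<forall>y\<in>H. x + y \<in> H) \<and> (\<forall>x\<in>H. - x \<in> H)"

definition subring :: "'a::ring set \<Rightarrow> bool" where
  "subring S \<longleftrightarrow> add_subgroup S \<and> (\<forall>x\<in>S. \<forall>y\<in>S. x * y \<in> S)"

definition is_identity :: "'a::ring set \<Rightarrow> 'a \<Rightarrow> bool" where
  "is_identity S u \<longleftrightarrow> u \<in> S \<and> (\<forall>x\<in>S. u * x = x \<and> x * u = x)"

definition identity_of :: "'a::ring set \<Rightarrow> 'a" where
  "identity_of S = (THE u. is_identity S u)"

definition unital :: "'a::ring set \<Rightarrow> bool" where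
  "unital S \<longleftrightarrow> (\<exists>u. is_identity S u)"

definition direct_sum :: "'g set \<Rightarrow> ('g \<Rightarrow> 'a::ring set) \<Rightarrow> 'a set \<Rightarrow> bool" where
  "direct_sum G C S \<longleftrightarrow>
    add_subgroup S \<and> (\<forall>g\<in>G. add_subgroup (C g) \<and> C g \<subseteq> S) \<and>
    (\<forall>x\<in>S. \<exists>!f. (\<forall>g\<in>G. f g \<in> C g) \<and> (\<forall>g. g \<notin> G \<longrightarrow> f g = 0) \<and>
       finite {g. f g \<noteq> 0} \<and> x = (\<Sum>g | f g \<noteq> 0. f g))"

text \<open>\<open>C g\<close> is the homogeneous component of degree \<open>g\<close>. Object unitality is part of the notion.\<close>

definition graded_ring ::
    "('g, 'm) small_cat_scheme \<Rightarrow> 'a::ring set \<Rightarrow> ('g \<Rightarrow> 'a set) \<Rightarrow> bool" where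
  "graded_ring \<Gamma> S C \<longleftrightarrow>
    subring S \<and> direct_sum (Mor \<Gamma>) C S \<and>
    (\<forall>g\<in>Mor \<Gamma>. \<forall>h\<in>Mor \<Gamma>. \<forall>a\<in>C g. \<forall>b\<in>C h.
       if dm \<Gamma> g = rg \<Gamma> h then a * b \<in> C (cmp \<Gamma> g h) else a * b = 0) \<and>
    (\<forall>e\<in>Idm \<Gamma>. \<exists>u. is_identity (C e) u) \<and>
    (\<forall>g\<in>Mor \<Gamma>. \<forall>a\<in>C g.
       identity_of (C (rg \<Gamma> g)) * a = a \<and> a * identity_of (C (dm \<Gamma> g)) = a)"

definition Idm' :: "('g, 'm) small_cat_scheme \<Rightarrow> ('g \<Rightarrow> 'a::ring set) \<Rightarrow> 'g set" where
  "Idm' \<Gamma> C = {e \<in> Idm \<Gamma>. identity_of (C e) \<noteq> 0}"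


section \<open>Graded ideals, chain conditions and the graded radical\<close>

definition right_ideal :: "'a::ring set \<Rightarrow> 'a set \<Rightarrow> bool" where
  "right_ideal S U \<longleftrightarrow> add_subgroup U \<and> U \<subseteq> S \<and> (\<forall>u\<in>U. \<forall>s\<in>S. u * s \<in> U)"

definition gr_right_ideal ::
    "('g, 'm) small_cat_scheme \<Rightarrow> 'a::ring set \<Rightarrow> ('g \<Rightarrow> 'a set) \<Rightarrow> 'a set \<Rightarrow> bool" where
  "gr_right_ideal \<Gamma> S C U \<longleftrightarrow> right_ideal S U \<and> direct_sum (Mor \<Gamma>) (\<lambda>g. U \<inter> C g) U"

definition right_gr_artinian ::
    "('g, 'm) small_cat_scheme \<Rightarrow> 'a::ring set \<Rightarrow> ('g \<Rightarrow> 'a set) \<Rightarrow> bool" where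
  "right_gr_artinian \<Gamma> S C \<longleftrightarrow>
    \<not> (\<exists>U :: nat \<Rightarrow> 'a set. \<forall>n. gr_right_ideal \<Gamma> S C (U n) \<and> U (Suc n) \<subset> U n)"

definition right_\<Gamma>0_artinian ::
    "('g, 'm) small_cat_scheme \<Rightarrow> 'a::ring set \<Rightarrow> ('g \<Rightarrow> 'a set) \<Rightarrow> bool" where
  "right_\<Gamma>0_artinian \<Gamma> S C \<longleftrightarrow>
    (\<forall>e\<in>Idm \<Gamma>. \<not> (\<exists>U :: nat \<Rightarrow> 'a set. \<forall>n. gr_right_ideal \<Gamma> S C (U n) \<and>
       U n \<subseteq> {identity_of (C e) * s | s. s \<in> S} \<and> U (Suc n) \<subset> U n))"

definition gr_maximal ::
    "('g, 'm) small_cat_scheme \<Rightarrow> 'a::ring set \<Rightarrow> ('g \<Rightarrow> 'a set) \<Rightarrow> 'a set \<Rightarrow> bool" where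
  "gr_maximal \<Gamma> S C U \<longleftrightarrow> gr_right_ideal \<Gamma> S C U \<and> U \<noteq> S \<and>
     (\<forall>V. gr_right_ideal \<Gamma> S C V \<and> V \<noteq> S \<and> U \<subseteq> V \<longrightarrow> V = U)"

text \<open>The intersection is formed inside \<open>S\<close>: it is \<open>S\<close> if there is no gr-maximal right ideal.\<close>

definition rad_gr ::
    "('g, 'm) small_cat_scheme \<Rightarrow> 'a::ring set \<Rightarrow> ('g \<Rightarrow> 'a set) \<Rightarrow> 'a set" where
  "rad_gr \<Gamma> S C = S \<inter> \<Inter> {U. gr_maximal \<Gamma> S C U}"

definition ideal_prod :: "'a::ring set \<Rightarrow> 'a set \<Rightarrow> 'a set" where
  "ideal_prod U V = \<Inter> {H. add_subgroup H \<and> {u * v | u v. u \<in> U \<and> v \<in> V} \<subseteq> H}"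

text \<open>The exponent is shifted: \<open>ideal_pow_Suc U n\<close> is the power of \<open>U\<close> with exponent \<open>n + 1\<close>.\<close>

primrec ideal_pow_Suc :: "'a::ring set \<Rightarrow> nat \<Rightarrow> 'a set" where
  "ideal_pow_Suc U 0 = U"
| "ideal_pow_Suc U (Suc n) = ideal_prod (ideal_pow_Suc U n) U"

definition nilpotent :: "'a::ring set \<Rightarrow> bool" where
  "nilpotent U \<longleftrightarrow> (\<exists>n. ideal_pow_Suc U n = {0})"


section \<open>Finitely supported matrices\<close>

typedef (overloaded) ('i, 'a::zero) fmat =
    "{A :: 'i \<Rightarrow> 'i \<Rightarrow> 'a. finite {(i, j). A i j \<noteq> 0}}"
  morphisms entry Fmat
proof
  show "(\<lambda>i j. 0) \<in> {A :: 'i \<Rightarrow> 'i \<Rightarrow> 'a. finite {(i, j). A i j \<noteq> 0}}" by simp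
qed

lemma fmat_eqI: "(\<And>i j. entry A i j = entry B i j) \<Longrightarrow> A = B"
  by (metis entry_inject ext)

lemma finite_entries: "finite {(i, j). entry A i j \<noteq> 0}"
  using entry[of A] by simp

lemma finite_row: "finite {k. entry A i k \<noteq> 0}"
proof -
  have "{k. entry A i k \<noteq> 0} \<subseteq> snd ` {(i, j). entry A i j \<noteq> 0}" by force
  then show ?thesis using finite_entries finite_surj by blast
qed

lemma entry_Fmat:
  assumes "finite T" "\<And>i j. F i j \<noteq> 0 \<Longrightarrow> (i, j) \<in> T"
  shows "entry (Fmat F) = F"
proof (rule Fmat_inverse)
  have "{(i, j). F i j \<noteq> 0} \<subseteq> T" using assms(2) by auto
  then show "F \<in> {A. finite {(i, j). A i j \<noteq> 0}}" using assms(1) finite_subset by auto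
qed

instantiation fmat :: (type, ring) ring
begin

definition "0 = Fmat (\<lambda>i j. 0)"
definition "A + B = Fmat (\<lambda>i j. entry A i j + entry B i j)"
definition "- A = Fmat (\<lambda>i j. - entry A i j)"
definition "A - B = Fmat (\<lambda>i j. entry A i j - entry B i j)"
definition "A * B = Fmat (\<lambda>i j. \<Sum>k | entry A i k \<noteq> 0. entry A i k * entry B k j)"

lemma entry_zero: "entry (0 :: ('a, 'b) fmat) i j = 0"
  unfolding zero_fmat_def by (subst entry_Fmat[of "{}"]) auto

lemma entry_plus: "entry (A + B :: ('a, 'b) fmat) i j = entry A i j + entry B i j"
  unfolding plus_fmat_def
  by (subst entry_Fmat[of "{(i, j). entry A i j \<noteq> 0} \<union> {(i, j). entry B i j \<noteq> 0}"])
    (auto simp: finite_entries)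

lemma entry_uminus: "entry (- A :: ('a, 'b) fmat) i j = - entry A i j"
  unfolding uminus_fmat_def
  by (subst entry_Fmat[of "{(i, j). entry A i j \<noteq> 0}"]) (auto simp: finite_entries)

lemma entry_minus: "entry (A - B :: ('a, 'b) fmat) i j = entry A i j - entry B i j"
  unfolding minus_fmat_def
  by (subst entry_Fmat[of "{(i, j). entry A i j \<noteq> 0} \<union> {(i, j). entry B i j \<noteq> 0}"])
    (auto simp: finite_entries)

lemma entry_times:
  "entry (A * B :: ('a, 'b) fmat) i j = (\<Sum>k | entry A i k \<noteq> 0. entry A i k * entry B k j)"
proof -
  let ?T = "(fst ` {(i, j). entry A i j \<noteq> 0}) \<times> (snd ` {(i, j). entry B i j \<noteq> 0})"
  have "(i, j) \<in> ?T" if "(\<Sum>k | entry A i k \<noteq> 0. entry A i k * entry B k j) \<noteq> 0" for i j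
  proof -
    from sum.not_neutral_contains_not_neutral[OF that]
    obtain k where "entry A i k \<noteq> 0" "entry A i k * entry B k j \<noteq> 0" by auto
    then have "entry A i k \<noteq> 0" "entry B k j \<noteq> 0" by auto
    then show ?thesis by force
  qed
  moreover have "finite ?T" using finite_entries by blast
  ultimately show ?thesis unfolding times_fmat_def by (subst entry_Fmat[of ?T]) auto
qed

lemma entry_times_superset:
  assumes "finite K" "\<And>k. entry A i k \<noteq> 0 \<Longrightarrow> entry B k j \<noteq> 0 \<Longrightarrow> k \<in> K"
  shows "entry (A * B :: ('a, 'b) fmat) i j = (\<Sum>k\<in>K. entry A i k * entry B k j)"
proof -
  have "entry A i k * entry B k j = 0" if "k \<notin> K" for k
    using assms(2) that by (metis mult_zero_left mult_zero_right)
  then show ?thesis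
    unfolding entry_times
    by (intro sum.mono_neutral_cong) (use assms(1) finite_row in auto)
qed

instance
proof
  fix A B C :: "('a, 'b) fmat"
  show "A + B + C = A + (B + C)" "A + B = B + A" "0 + A = A" "- A + A = 0" "A - B = A + - B"
    by (rule fmat_eqI; simp add: entry_zero entry_plus entry_uminus entry_minus add.assoc add.commute)+
  show "(A + B) * C = A * C + B * C"
  proof (rule fmat_eqI)
    fix i j
    let ?K = "{k. entry A i k \<noteq> 0} \<union> {k. entry B i k \<noteq> 0}"
    have K: "finite ?K" by (simp add: finite_row)
    show "entry ((A + B) * C) i j = entry (A * C + B * C) i j"
      unfolding entry_plus
      by (subst (1 2 3) entry_times_superset[OF K])
        (auto simp: entry_plus distrib_right sum.distrib)
  qed
  show "A * (B + C) = A * B + A * C"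
    by (rule fmat_eqI) (simp add: entry_plus entry_times distrib_left sum.distrib)
  show "A * B * C = A * (B * C)"
  proof (rule fmat_eqI)
    fix i j
    let ?K = "{k. entry A i k \<noteq> 0}" and ?L = "snd ` {(k, l). entry B k l \<noteq> 0}"
    have L: "finite ?L" using finite_entries by blast
    have in_L: "l \<in> ?L" if "entry B k l \<noteq> 0" for k l using that by force
    have AB: "l \<in> ?L" if "entry (A * B) i l \<noteq> 0" for l
    proof (rule ccontr)
      assume "l \<notin> ?L"
      then have "entry B k l = 0" for k using in_L by blast
      then show False using that by (simp add: entry_times)
    qed
    have "entry (A * B * C) i j = (\<Sum>l\<in>?L. entry (A * B) i l * entry C l j)"
      by (rule entry_times_superset[OF L]) (use AB in blast)
    also have "\<dots> = (\<Sum>l\<in>?L. \<Sum>k\<in>?K. entry A i k * entry B k l * entry C l j)"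
      by (simp add: entry_times sum_distrib_right)
    also have "\<dots> = (\<Sum>k\<in>?K. \<Sum>l\<in>?L. entry A i k * entry B k l * entry C l j)"
      by (rule sum.swap)
    also have "\<dots> = (\<Sum>k\<in>?K. entry A i k * (\<Sum>l\<in>?L. entry B k l * entry C l j))"
      by (simp add: sum_distrib_left mult.assoc)
    also have "\<dots> = (\<Sum>k\<in>?K. entry A i k * entry (B * C) k j)"
      by (subst entry_times_superset[OF L]) (use in_L in blast, simp)
    also have "\<dots> = entry (A * (B * C)) i j" by (simp add: entry_times)
    finally show "entry (A * B * C) i j = entry (A * (B * C)) i j" .
  qed
qed

end


section \<open>Graded matrix rings\<close>

definition fully_matricial ::
    "('g, 'm) small_cat_scheme \<Rightarrow> ('g \<Rightarrow> 'a::ring set) \<Rightarrow> 'i set \<Rightarrow> ('i \<Rightarrow> 'g set) \<Rightarrow> bool" where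
  "fully_matricial \<Gamma> C I \<Sigma> \<longleftrightarrow>
    (\<forall>i\<in>I. \<Sigma> i \<subseteq> Mor \<Gamma> \<and> \<Sigma> i \<noteq> {}) \<and>
    (\<forall>e\<in>Idm \<Gamma>. finite {i \<in> I. \<exists>s\<in>\<Sigma> i. dm \<Gamma> s = e}) \<and>
    (\<forall>i\<in>I. inj_on (dm \<Gamma>) (\<Sigma> i)) \<and>
    (\<forall>i\<in>I. bij_betw (rg \<Gamma>) (\<Sigma> i) (Idm' \<Gamma> C))"

definition mat_carrier :: "'a::ring set \<Rightarrow> 'i set \<Rightarrow> ('i, 'a) fmat set" where
  "mat_carrier R I =
    {A. \<forall>i j. entry A i j \<in> R \<and> (i \<notin> I \<or> j \<notin> I \<longrightarrow> entry A i j = 0)}"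

text \<open>Used only for sets with at most one element.\<close>

definition comp_at :: "('g \<Rightarrow> 'a::ring set) \<Rightarrow> 'g set \<Rightarrow> 'a set" where
  "comp_at C X = (if X = {} then {0} else C (the_elem X))"

definition mat_comp ::
    "('g, 'm) small_cat_scheme \<Rightarrow> 'a::ring set \<Rightarrow> ('g \<Rightarrow> 'a set) \<Rightarrow> 'i set \<Rightarrow> ('i \<Rightarrow> 'g set) \<Rightarrow>
     'g \<Rightarrow> ('i, 'a) fmat set" where
  "mat_comp \<Gamma> R C I \<Sigma> g =
    {A \<in> mat_carrier R I. \<forall>i\<in>I. \<forall>j\<in>I.
       entry A i j \<in> comp_at C (cmp_set \<Gamma> (cmp_set \<Gamma> (\<Sigma> i) {g}) (inv_set \<Gamma> (\<Sigma> j)))}"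

end

theory Submission
  imports Defs
begin

text \<open>
  Let \<open>N\<close> be the graded radical of \<open>R\<close>. The powers of \<open>N\<close> stabilise at some \<open>B = B B\<close>. If \<open>B\<close> were
  nonzero, a graded right ideal \<open>K\<close> minimal with \<open>K B \<noteq> 0\<close> would be of the form \<open>k B\<close> with \<open>k\<close>
  homogeneous of some degree \<open>g\<close>, so \<open>k = k b\<close> with \<open>b \<in> B\<close> of degree \<open>d(g)\<close>; since \<open>1 - b\<close> is right
  invertible, \<open>k = 0\<close>. So \<open>N\<close> is nilpotent.

  For matrices, the entries at a fixed position \<open>(i, j)\<close> of the elements of a graded right ideal
  form a graded right ideal of \<open>R\<close> that does not depend on \<open>j\<close>. The matrices in \<open>1\<^sub>e M\<close> have only finitely
  many nonzero rows, which gives the chain condition. If \<open>m\<close> is gr-maximal in \<open>R\<close>, the matrices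
  whose row \<open>i\<close> lies in \<open>m\<close> form a gr-maximal right ideal; hence all entries of the graded radical
  of the matrix ring lie in \<open>N\<close>.
\<close>

section \<open>Homogeneous parts\<close>

lemma add_subgroup_zero: "add_subgroup H \<Longrightarrow> 0 \<in> H"
  and add_subgroup_add: "add_subgroup H \<Longrightarrow> x \<in> H \<Longrightarrow> y \<in> H \<Longrightarrow> x + y \<in> H"
  and add_subgroup_uminus: "add_subgroup H \<Longrightarrow> x \<in> H \<Longrightarrow> - x \<in> H"
  by (auto simp: add_subgroup_def)

lemma add_subgroup_diff: "add_subgroup H \<Longrightarrow> x \<in> H \<Longrightarrow> y \<in> H \<Longrightarrow> x - y \<in> H"
  by (metis add_subgroup_add add_subgroup_uminus diff_conv_add_uminus)

lemma add_subgroup_sum: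
  assumes "add_subgroup H" "\<And>k. k \<in> K \<Longrightarrow> f k \<in> H"
  shows "sum f K \<in> H"
  using assms(2)
  by (induction K rule: infinite_finite_induct)
    (auto intro: add_subgroup_zero[OF assms(1)] add_subgroup_add[OF assms(1)])

text \<open>The condition under the uniqueness quantifier of \<open>direct_sum\<close>, named so
  that uniqueness can be applied to a given family \<open>f\<close>.\<close>

definition decomposes :: "'g set \<Rightarrow> ('g \<Rightarrow> 'a::ring set) \<Rightarrow> ('g \<Rightarrow> 'a) \<Rightarrow> 'a \<Rightarrow> bool" where
  "decomposes G C f x \<longleftrightarrow> (\<forall>g\<in>G. f g \<in> C g) \<and> (\<forall>g. g \<notin> G \<longrightarrow> f g = 0) \<and>
     finite {g. f g \<noteq> 0} \<and> x = (\<Sum>g | f g \<noteq> 0. f g)"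

text \<open>Meaningful only for \<open>x\<close> in the direct sum, where exactly one decomposition
  exists.\<close>

definition hpart :: "'g set \<Rightarrow> ('g \<Rightarrow> 'a::ring set) \<Rightarrow> 'a \<Rightarrow> 'g \<Rightarrow> 'a" where
  "hpart G C x = (THE f. decomposes G C f x)"

lemma direct_sum_iff:
  "direct_sum G C S \<longleftrightarrow> add_subgroup S \<and> (\<forall>g\<in>G. add_subgroup (C g) \<and> C g \<subseteq> S) \<and>
    (\<forall>x\<in>S. \<exists>!f. decomposes G C f x)"
  by (simp add: direct_sum_def decomposes_def)

text \<open>The sum may run over any finite \<open>K\<close> containing the support, so families
  with different supports can be added over a common index set.\<close>

lemma decomposesI:
  assumes "\<And>g. g \<in> G \<Longrightarrow> f g \<in> C g" "\<And>g. g \<notin> G \<Longrightarrow> f g = 0"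
    and "finite K" "\<And>g. f g \<noteq> 0 \<Longrightarrow> g \<in> K" "x = sum f K"
  shows "decomposes G C f x"
proof -
  have "{g. f g \<noteq> 0} \<subseteq> K" using assms(4) by blast
  moreover from this have "sum f {g. f g \<noteq> 0} = sum f K"
    using assms(3) by (intro sum.mono_neutral_left) auto
  ultimately show ?thesis
    using assms finite_subset unfolding decomposes_def by auto
qed

locale grading =
  fixes G :: "'g set" and C :: "'g \<Rightarrow> 'a::ring set" and S :: "'a set"
  assumes direct_sum: "direct_sum G C S"
begin

lemma subgroup: "add_subgroup S"
  and comp_subgroup: "g \<in> G \<Longrightarrow> add_subgroup (C g)"
  and comp_subset: "g \<in> G \<Longrightarrow> C g \<subseteq> S"
  and unique_decomposition: "x \<in> S \<Longrightarrow> \<exists>!f. decomposes G C f x"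
  using direct_sum unfolding direct_sum_iff by auto

lemma decomposes_hpart: "x \<in> S \<Longrightarrow> decomposes G C (hpart G C x) x"
  unfolding hpart_def by (rule theI'[OF unique_decomposition])

lemma hpart_eqI: "x \<in> S \<Longrightarrow> decomposes G C f x \<Longrightarrow> hpart G C x = f"
  using decomposes_hpart unique_decomposition by blast

lemma hpart_in: "x \<in> S \<Longrightarrow> g \<in> G \<Longrightarrow> hpart G C x g \<in> C g"
  and hpart_outside: "x \<in> S \<Longrightarrow> g \<notin> G \<Longrightarrow> hpart G C x g = 0"
  and finite_hpart: "x \<in> S \<Longrightarrow> finite {g. hpart G C x g \<noteq> 0}"
  and sum_hpart: "x \<in> S \<Longrightarrow> (\<Sum>g | hpart G C x g \<noteq> 0. hpart G C x g) = x"
  using decomposes_hpart[of x] unfolding decomposes_def by auto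

lemma hpart_homogeneous:
  assumes "g \<in> G" "x \<in> C g"
  shows "hpart G C x h = (if h = g then x else 0)"
proof -
  have "hpart G C x = (\<lambda>h. if h = g then x else 0)"
    using assms comp_subset
    by (intro hpart_eqI decomposesI[where K = "{g}"])
      (auto intro: add_subgroup_zero comp_subgroup split: if_splits)
  then show ?thesis by simp
qed

lemma hpart_zero: "hpart G C 0 h = 0"
proof -
  have "hpart G C 0 = (\<lambda>h. 0)"
    by (intro hpart_eqI decomposesI[where K = "{}"])
      (auto intro: add_subgroup_zero comp_subgroup subgroup)
  then show ?thesis by simp
qed

lemma hpart_add:
  assumes "x \<in> S" "y \<in> S"
  shows "hpart G C (x + y) h = hpart G C x h + hpart G C y h"
proof -
  let ?K = "{g. hpart G C x g \<noteq> 0} \<union> {g. hpart G C y g \<noteq> 0}"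
  have K: "finite ?K" using assms by (simp add: finite_hpart)
  have "sum (hpart G C z) ?K = z" if "z \<in> S" "{g. hpart G C z g \<noteq> 0} \<subseteq> ?K" for z
    using sum.mono_neutral_left[OF K that(2), of "hpart G C z"] sum_hpart[OF that(1)] by auto
  then have "hpart G C (x + y) = (\<lambda>h. hpart G C x h + hpart G C y h)"
    using assms
    by (intro hpart_eqI decomposesI[where K = ?K] add_subgroup_add[OF subgroup] K)
      (auto intro: add_subgroup_add[OF comp_subgroup] hpart_in simp: hpart_outside sum.distrib)
  then show ?thesis by simp
qed

lemma hpart_uminus:
  assumes "x \<in> S"
  shows "hpart G C (- x) h = - hpart G C x h"
  using hpart_add[OF assms add_subgroup_uminus[OF subgroup assms], of h]
  by (simp add: hpart_zero add_eq_0_iff)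

lemma hpart_sum:
  assumes "\<And>k. k \<in> K \<Longrightarrow> f k \<in> S"
  shows "hpart G C (sum f K) h = (\<Sum>k\<in>K. hpart G C (f k) h)"
  using assms
  by (induction K rule: infinite_finite_induct)
    (auto simp: hpart_zero hpart_add add_subgroup_sum[OF subgroup])

text \<open>A decomposition inside \<open>U\<close> is also one inside \<open>S\<close>, hence
  equals \<open>hpart G C x\<close>. Gradedness thus becomes closure under homogeneous components,
  the form in which it is checked from here on.\<close>

lemma graded_iff:
  assumes "add_subgroup U" "U \<subseteq> S"
  shows "direct_sum G (\<lambda>g. U \<inter> C g) U \<longleftrightarrow> (\<forall>x\<in>U. \<forall>g\<in>G. hpart G C x g \<in> U)"
    (is "?L \<longleftrightarrow> ?R")
proof
  assume ?L
  show ?R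
  proof (intro ballI)
    fix x g assume x: "x \<in> U" and g: "g \<in> G"
    obtain f where f: "decomposes G (\<lambda>g. U \<inter> C g) f x"
      using \<open>?L\<close> x unfolding direct_sum_iff by blast
    then have "decomposes G C f x" by (auto simp: decomposes_def)
    then have "hpart G C x = f" using hpart_eqI assms(2) x by blast
    then show "hpart G C x g \<in> U" using f g by (auto simp: decomposes_def)
  qed
next
  assume ?R
  have "\<exists>!f. decomposes G (\<lambda>g. U \<inter> C g) f x" if x: "x \<in> U" for x
  proof (rule ex1I)
    show "decomposes G (\<lambda>g. U \<inter> C g) (hpart G C x) x"
      using \<open>?R\<close> x decomposes_hpart[of x] assms(2) by (auto simp: decomposes_def)
    fix f assume "decomposes G (\<lambda>g. U \<inter> C g) f x"
    then have "decomposes G C f x" by (auto simp: decomposes_def)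
    then show "f = hpart G C x" using hpart_eqI assms(2) x by blast
  qed
  moreover have "add_subgroup (U \<inter> C g)" if "g \<in> G" for g
    using assms(1) comp_subgroup[OF that] by (auto simp: add_subgroup_def)
  ultimately show ?L using assms(1) unfolding direct_sum_iff by blast
qed

text \<open>Taking components is additive. With this subgroup as \<open>H\<close> in
  \<open>ideal_prod_subsetI\<close>, closure of an ideal product under components need only be
  checked on products of two elements.\<close>

lemma subgroup_hpart_in:
  assumes "add_subgroup U"
  shows "add_subgroup {x \<in> S. \<forall>g\<in>G. hpart G C x g \<in> U}"
  using assms subgroup
  by (auto simp: add_subgroup_def[of "{x \<in> S. _ x}"] hpart_zero hpart_add hpart_uminus
      intro: add_subgroup_zero add_subgroup_add add_subgroup_uminus)

text \<open>Each component of a homogeneous summand is the summand itself or zero.\<close>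

lemma hpart_in_if_sum:
  assumes "add_subgroup U" "U \<subseteq> S" "\<And>k. k \<in> K \<Longrightarrow> f k \<in> U \<and> (\<exists>h\<in>G. f k \<in> C h)"
  shows "hpart G C (sum f K) g \<in> U"
proof -
  have "hpart G C (f k) g \<in> U" if "k \<in> K" for k
    using assms(3)[OF that] add_subgroup_zero[OF assms(1)] by (auto simp: hpart_homogeneous)
  then show ?thesis
    using assms by (subst hpart_sum) (auto intro: add_subgroup_sum)
qed

end

lemma gr_right_ideal_iff:
  assumes "direct_sum (Mor \<Gamma>) C S"
  shows "gr_right_ideal \<Gamma> S C U \<longleftrightarrow>
    right_ideal S U \<and> (\<forall>x\<in>U. \<forall>g\<in>Mor \<Gamma>. hpart (Mor \<Gamma>) C x g \<in> U)"
proof -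
  interpret grading "Mor \<Gamma>" C S using assms by (rule grading.intro)
  show ?thesis
    unfolding gr_right_ideal_def right_ideal_def using graded_iff by blast
qed


section \<open>Products of ideals\<close>

lemma add_subgroup_ideal_prod: "add_subgroup (ideal_prod U V)"
  unfolding ideal_prod_def by (auto simp: add_subgroup_def)

lemma mult_in_ideal_prod: "u \<in> U \<Longrightarrow> v \<in> V \<Longrightarrow> u * v \<in> ideal_prod U V"
  unfolding ideal_prod_def by blast

lemma ideal_prod_subsetI:
  "add_subgroup H \<Longrightarrow> (\<And>u v. u \<in> U \<Longrightarrow> v \<in> V \<Longrightarrow> u * v \<in> H) \<Longrightarrow> ideal_prod U V \<subseteq> H"
  unfolding ideal_prod_def by blast

text \<open>This and its right-hand analogue serve as \<open>H\<close> in
  \<open>ideal_prod_subsetI\<close>: a claim about \<open>a * x\<close> for all \<open>x\<close> in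
  an ideal product reduces to the generating products.\<close>

lemma add_subgroup_left_mult:
  "add_subgroup H \<Longrightarrow> add_subgroup {x. a * x \<in> (H :: 'a::ring set)}"
  by (auto simp: add_subgroup_def distrib_left)

lemma add_subgroup_right_mult:
  "add_subgroup H \<Longrightarrow> add_subgroup {x. x * a \<in> (H :: 'a::ring set)}"
  by (auto simp: add_subgroup_def distrib_right)

lemma ideal_prod_assoc: "ideal_prod (ideal_prod U V) W = ideal_prod U (ideal_prod V W)"
proof
  have "x * w \<in> ideal_prod U (ideal_prod V W)" if "x \<in> ideal_prod U V" and w: "w \<in> W" for x w
  proof -
    have "ideal_prod U V \<subseteq> {x. x * w \<in> ideal_prod U (ideal_prod V W)}"
      by (rule ideal_prod_subsetI[OF add_subgroup_right_mult[OF add_subgroup_ideal_prod]])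
        (auto simp: mult.assoc intro!: mult_in_ideal_prod w)
    then show ?thesis using that by blast
  qed
  then show "ideal_prod (ideal_prod U V) W \<subseteq> ideal_prod U (ideal_prod V W)"
    by (rule ideal_prod_subsetI[OF add_subgroup_ideal_prod])
  have "u * x \<in> ideal_prod (ideal_prod U V) W" if u: "u \<in> U" and "x \<in> ideal_prod V W" for u x
  proof -
    have "ideal_prod V W \<subseteq> {x. u * x \<in> ideal_prod (ideal_prod U V) W}"
      by (rule ideal_prod_subsetI[OF add_subgroup_left_mult[OF add_subgroup_ideal_prod]])
        (auto simp flip: mult.assoc intro!: mult_in_ideal_prod u)
    then show ?thesis using that by blast
  qed
  then show "ideal_prod U (ideal_prod V W) \<subseteq> ideal_prod (ideal_prod U V) W"
    by (rule ideal_prod_subsetI[OF add_subgroup_ideal_prod])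
qed

text \<open>With the shifted exponents, \<open>m + 1\<close> plus \<open>n + 1\<close> is
  \<open>m + n + 2\<close>, which has index \<open>Suc (m + n)\<close>.\<close>

lemma ideal_prod_pow:
  "ideal_prod (ideal_pow_Suc U m) (ideal_pow_Suc U n) = ideal_pow_Suc U (Suc (m + n))"
  by (induction n) (simp_all flip: ideal_prod_assoc)


section \<open>Chain conditions\<close>

text \<open>The chain condition makes strict inclusion well-founded among the sets with
  \<open>P\<close>; \<open>Q\<close> is the further property for which a minimal set is
  sought.\<close>

lemma no_descending_chain_min:
  assumes "\<not> (\<exists>U :: nat \<Rightarrow> 'b set. \<forall>n. P (U n) \<and> U (Suc n) \<subset> U n)" "P U" "Q U"
  obtains V where "P V" "Q V" "\<And>W. P W \<Longrightarrow> Q W \<Longrightarrow> W \<subseteq> V \<Longrightarrow> W = V"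
proof -
  have wf: "wf {(V, U). P V \<and> P U \<and> V \<subset> U}"
    unfolding wf_iff_no_infinite_down_chain using assms(1) by blast
  obtain V where V: "V \<in> {U. P U \<and> Q U}"
    and min: "\<And>W. (W, V) \<in> {(V, U). P V \<and> P U \<and> V \<subset> U} \<Longrightarrow> W \<notin> {U. P U \<and> Q U}"
    by (rule wfE_min[OF wf, of U "{U. P U \<and> Q U}"]) (use assms in auto)
  show thesis
  proof (rule that)
    fix W assume "P W" "Q W" "W \<subseteq> V"
    then show "W = V" using min[of W] V by blast
  qed (use V in auto)
qed

text \<open>A minimal member of the range of \<open>U\<close> cannot be undercut by a later
  term.\<close>

lemma no_descending_chain_stable:
  assumes "\<not> (\<exists>U :: nat \<Rightarrow> 'b set. \<forall>n. P (U n) \<and> U (Suc n) \<subset> U n)"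
    and "\<And>n. P (U n)" "\<And>n. U (Suc n) \<subseteq> U n"
  obtains n where "\<And>m. n \<le> m \<Longrightarrow> U m = U n"
proof -
  obtain V where V: "P V" "V \<in> range U" "\<And>W. P W \<Longrightarrow> W \<in> range U \<Longrightarrow> W \<subseteq> V \<Longrightarrow> W = V"
    by (rule no_descending_chain_min[OF assms(1,2), of "\<lambda>V. V \<in> range U" 0]) auto
  then obtain n where n: "V = U n" by blast
  have "U m \<subseteq> U n" if "n \<le> m" for m using lift_Suc_antimono_le[of U, OF assms(3) that] .
  then show thesis using that[of n] V(3) assms(2) n by blast
qed


section \<open>Nilpotency of the graded radical of a gr-artinian ring\<close>

text \<open>The type class \<open>ring\<close> supplies no unit, so the identity of \<open>R\<close>
  is a parameter \<open>u\<close>.\<close>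

locale unital_graded_ring =
  fixes \<Gamma> :: "('g, 'm) small_cat_scheme" and R :: "'a::ring set" and C :: "'g \<Rightarrow> 'a set"
    and u :: 'a
  assumes groupoid: "groupoid \<Gamma>" and graded_ring: "graded_ring \<Gamma> R C"
    and identity: "is_identity R u"
begin

sublocale grading "Mor \<Gamma>" C R
  using graded_ring by (simp add: grading_def graded_ring_def)

abbreviation "part \<equiv> hpart (Mor \<Gamma>) C"

lemma mult_closed: "x \<in> R \<Longrightarrow> y \<in> R \<Longrightarrow> x * y \<in> R"
  using graded_ring by (auto simp: graded_ring_def subring_def)

lemma u_in: "u \<in> R" and u_left: "x \<in> R \<Longrightarrow> u * x = x" and u_right: "x \<in> R \<Longrightarrow> x * u = x"
  using identity by (auto simp: is_identity_def)

lemma comp_mult: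
  assumes "g \<in> Mor \<Gamma>" "h \<in> Mor \<Gamma>" "a \<in> C g" "b \<in> C h"
  shows "if dm \<Gamma> g = rg \<Gamma> h then a * b \<in> C (cmp \<Gamma> g h) else a * b = 0"
  using graded_ring assms unfolding graded_ring_def by blast

section \<open>Identities, inverses and cancellation in the groupoid\<close>

lemma category:
  assumes "x \<in> Mor \<Gamma>"
  shows "dm \<Gamma> x \<in> Mor \<Gamma>" "rg \<Gamma> x \<in> Mor \<Gamma>" "dm \<Gamma> (dm \<Gamma> x) = dm \<Gamma> x" "rg \<Gamma> (dm \<Gamma> x) = dm \<Gamma> x"
    "dm \<Gamma> (rg \<Gamma> x) = rg \<Gamma> x" "rg \<Gamma> (rg \<Gamma> x) = rg \<Gamma> x"
    "cmp \<Gamma> x (dm \<Gamma> x) = x" "cmp \<Gamma> (rg \<Gamma> x) x = x"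
  using groupoid assms unfolding groupoid_def small_category_def by auto

lemma cmp_closed:
  assumes "x \<in> Mor \<Gamma>" "y \<in> Mor \<Gamma>" "dm \<Gamma> x = rg \<Gamma> y"
  shows "cmp \<Gamma> x y \<in> Mor \<Gamma>" "dm \<Gamma> (cmp \<Gamma> x y) = dm \<Gamma> y" "rg \<Gamma> (cmp \<Gamma> x y) = rg \<Gamma> x"
  using groupoid assms unfolding groupoid_def small_category_def by auto

lemma cmp_assoc:
  assumes "x \<in> Mor \<Gamma>" "y \<in> Mor \<Gamma>" "z \<in> Mor \<Gamma>" "dm \<Gamma> x = rg \<Gamma> y" "dm \<Gamma> y = rg \<Gamma> z"
  shows "cmp \<Gamma> (cmp \<Gamma> x y) z = cmp \<Gamma> x (cmp \<Gamma> y z)"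
  using groupoid assms unfolding groupoid_def small_category_def by auto

text \<open>Two inverses satisfy \<open>z = z (x y) = (z x) y = y\<close>, which justifies the
  definite description in \<open>inv_mor\<close>.\<close>

lemma is_inverse_inv_mor:
  assumes x: "x \<in> Mor \<Gamma>"
  shows "is_inverse \<Gamma> x (inv_mor \<Gamma> x)"
proof -
  obtain y where y: "is_inverse \<Gamma> x y" using groupoid x unfolding groupoid_def by blast
  have "z = y" if z: "is_inverse \<Gamma> x z" for z
  proof -
    have "z = cmp \<Gamma> z (cmp \<Gamma> x y)" using y z category(7)[of z] by (auto simp: is_inverse_def)
    also have "\<dots> = cmp \<Gamma> (cmp \<Gamma> z x) y"
      using y z x by (intro cmp_assoc[symmetric]) (auto simp: is_inverse_def)
    also have "\<dots> = y" using y z category(8)[of y] by (auto simp: is_inverse_def)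
    finally show ?thesis .
  qed
  with y show ?thesis unfolding inv_mor_def by (rule theI)
qed

lemma inv_mor:
  assumes "x \<in> Mor \<Gamma>"
  shows "inv_mor \<Gamma> x \<in> Mor \<Gamma>" "dm \<Gamma> (inv_mor \<Gamma> x) = rg \<Gamma> x" "rg \<Gamma> (inv_mor \<Gamma> x) = dm \<Gamma> x"
    "cmp \<Gamma> (inv_mor \<Gamma> x) x = dm \<Gamma> x" "cmp \<Gamma> x (inv_mor \<Gamma> x) = rg \<Gamma> x"
  using is_inverse_inv_mor[OF assms] by (auto simp: is_inverse_def)

lemma inv_mor_cancel_left:
  assumes "x \<in> Mor \<Gamma>" "y \<in> Mor \<Gamma>" "dm \<Gamma> x = rg \<Gamma> y"
  shows "cmp \<Gamma> (inv_mor \<Gamma> x) (cmp \<Gamma> x y) = y"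
  using assms cmp_assoc[of "inv_mor \<Gamma> x" x y] by (simp add: inv_mor category)

lemma inv_mor_cancel_right:
  assumes "x \<in> Mor \<Gamma>" "y \<in> Mor \<Gamma>" "dm \<Gamma> y = dm \<Gamma> x"
  shows "cmp \<Gamma> (cmp \<Gamma> y (inv_mor \<Gamma> x)) x = y"
proof -
  have "cmp \<Gamma> (cmp \<Gamma> y (inv_mor \<Gamma> x)) x = cmp \<Gamma> y (cmp \<Gamma> (inv_mor \<Gamma> x) x)"
    using assms by (intro cmp_assoc) (simp_all add: inv_mor)
  then show ?thesis using assms category(7)[of y] by (simp add: inv_mor)
qed

section \<open>Graded right ideals and the existence of gr-maximal ones\<close>

lemma gr_right_ideal_iff_part:
  "gr_right_ideal \<Gamma> R C U \<longleftrightarrow> right_ideal R U \<and> (\<forall>x\<in>U. \<forall>g\<in>Mor \<Gamma>. part x g \<in> U)"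
  by (rule gr_right_ideal_iff[OF direct_sum])

lemma gr_right_ideal_R: "gr_right_ideal \<Gamma> R C R"
  unfolding gr_right_ideal_iff_part right_ideal_def
  using subgroup mult_closed hpart_in comp_subset by blast

text \<open>Intersecting with \<open>R\<close> covers the empty family, as in
  \<open>rad_gr\<close>.\<close>

lemma gr_right_ideal_Inter:
  assumes "\<And>U. U \<in> \<U> \<Longrightarrow> gr_right_ideal \<Gamma> R C U"
  shows "gr_right_ideal \<Gamma> R C (R \<inter> \<Inter> \<U>)"
  using assms gr_right_ideal_R
  unfolding gr_right_ideal_iff_part right_ideal_def add_subgroup_def by simp

lemma gr_right_ideal_rad: "gr_right_ideal \<Gamma> R C (rad_gr \<Gamma> R C)"
  unfolding rad_gr_def by (rule gr_right_ideal_Inter) (auto simp: gr_maximal_def)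

lemma gr_right_ideal_eq_R: "right_ideal R U \<Longrightarrow> u \<in> U \<Longrightarrow> U = R"
  unfolding right_ideal_def using u_left by (metis subsetI subset_antisym)

text \<open>Zorn's lemma. Properness is expressed as \<open>u \<notin> V\<close>, a condition that
  passes to unions of chains.\<close>

lemma ex_gr_maximal:
  assumes T: "gr_right_ideal \<Gamma> R C T" "T \<noteq> R"
  obtains U where "gr_maximal \<Gamma> R C U" "T \<subseteq> U"
proof -
  let ?A = "{V. gr_right_ideal \<Gamma> R C V \<and> T \<subseteq> V \<and> u \<notin> V}"
  have TA: "T \<in> ?A" using T gr_right_ideal_eq_R[of T] by (auto simp: gr_right_ideal_def)
  have chains: "\<Union> \<C> \<in> ?A" if ne: "\<C> \<noteq> {}" and ch: "subset.chain ?A \<C>" for \<C>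
  proof -
    have sub: "\<C> \<subseteq> ?A" and tot: "\<And>V W. V \<in> \<C> \<Longrightarrow> W \<in> \<C> \<Longrightarrow> V \<subseteq> W \<or> W \<subseteq> V"
      using ch by (auto simp: subset_chain_def)
    have gr: "gr_right_ideal \<Gamma> R C V" if "V \<in> \<C>" for V using sub that by blast
    have ri: "right_ideal R V" and pt: "\<forall>x\<in>V. \<forall>g\<in>Mor \<Gamma>. part x g \<in> V" if "V \<in> \<C>" for V
      using gr[OF that] by (auto simp: gr_right_ideal_iff_part)
    have el: "0 \<in> V" "x \<in> V \<Longrightarrow> y \<in> V \<Longrightarrow> x + y \<in> V" "x \<in> V \<Longrightarrow> - x \<in> V"
      "x \<in> V \<Longrightarrow> s \<in> R \<Longrightarrow> x * s \<in> V" "x \<in> V \<Longrightarrow> x \<in> R" if "V \<in> \<C>" for V x y s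
      using ri[OF that] by (auto simp: right_ideal_def add_subgroup_def)
    have "add_subgroup (\<Union> \<C>)"
      unfolding add_subgroup_def
    proof (intro conjI ballI)
      show "0 \<in> \<Union> \<C>" using ne el(1) by blast
      show "- x \<in> \<Union> \<C>" if "x \<in> \<Union> \<C>" for x using that el(3) by blast
      fix x y assume "x \<in> \<Union> \<C>" "y \<in> \<Union> \<C>"
      then obtain V W where VW: "V \<in> \<C>" "W \<in> \<C>" "x \<in> V" "y \<in> W" by blast
      then have "V \<subseteq> W \<or> W \<subseteq> V" using tot by blast
      then obtain Z where "Z \<in> \<C>" "x \<in> Z" "y \<in> Z" using VW by blast
      then show "x + y \<in> \<Union> \<C>" using el(2) by blast
    qed
    moreover have "\<Union> \<C> \<subseteq> R" using el(5) by blast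
    moreover have "\<forall>x\<in>\<Union> \<C>. \<forall>s\<in>R. x * s \<in> \<Union> \<C>" using el(4) by blast
    ultimately have "right_ideal R (\<Union> \<C>)" unfolding right_ideal_def by blast
    moreover have "\<forall>x\<in>\<Union> \<C>. \<forall>g\<in>Mor \<Gamma>. part x g \<in> \<Union> \<C>" using pt by blast
    ultimately have "gr_right_ideal \<Gamma> R C (\<Union> \<C>)" unfolding gr_right_ideal_iff_part by (rule conjI)
    moreover have "T \<subseteq> \<Union> \<C>"
    proof -
      obtain V where V: "V \<in> \<C>" using ne by blast
      then have "T \<subseteq> V" using sub by auto
      then show ?thesis using V by blast
    qed
    moreover have "u \<notin> \<Union> \<C>" using sub by auto
    ultimately show ?thesis by blast
  qed
  have "\<exists>U\<in>?A. \<forall>V\<in>?A. U \<subseteq> V \<longrightarrow> V = U"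
  proof (rule subset_Zorn_nonempty)
    show "?A \<noteq> {}" using TA by (metis empty_iff)
  qed (rule chains)
  then obtain U where "U \<in> ?A" and max: "\<forall>V\<in>?A. U \<subseteq> V \<longrightarrow> V = U" by (rule bexE)
  then have U: "gr_right_ideal \<Gamma> R C U" "T \<subseteq> U" "u \<notin> U" by simp_all
  have "V = U" if V: "gr_right_ideal \<Gamma> R C V" "V \<noteq> R" "U \<subseteq> V" for V
  proof -
    have "u \<notin> V" using V gr_right_ideal_eq_R[of V] by (auto simp: gr_right_ideal_def)
    then have "V \<in> ?A" using V U(2) by simp
    then show ?thesis using max V(3) by simp
  qed
  then have "gr_maximal \<Gamma> R C U" using U u_in unfolding gr_maximal_def by metis
  then show thesis using that U(2) by simp
qed

text \<open>Multiplication by \<open>u - b\<close> preserves degrees, so the right ideal it generates is graded;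
  it is not contained in any gr-maximal right ideal.\<close>

lemma rad_quasi_regular:
  assumes b: "b \<in> rad_gr \<Gamma> R C" "b \<in> C e" and e: "e \<in> Mor \<Gamma>" "dm \<Gamma> e = e"
  obtains x where "x \<in> R" "(u - b) * x = u"
proof -
  have bR: "b \<in> R" using b by (simp add: rad_gr_def)
  have ubR: "u - b \<in> R" using add_subgroup_diff[OF subgroup u_in bR] .
  let ?T = "(*) (u - b) ` R"
  have sub: "add_subgroup ?T"
    unfolding add_subgroup_def using subgroup
    by (auto simp: add_subgroup_def image_iff simp flip: distrib_left mult_minus_right)
      (metis mult_zero_right)
  have TR: "?T \<subseteq> R" using ubR mult_closed by blast
  have ri: "right_ideal R ?T"
    unfolding right_ideal_def using sub TR mult_closed by (auto simp: mult.assoc)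
  have rge: "rg \<Gamma> e = e" using category(4)[OF e(1)] e(2) by simp
  have deg: "(u - b) * y \<in> C g" if "y \<in> C g" "g \<in> Mor \<Gamma>" for y g
  proof -
    have "b * y \<in> C g"
      using comp_mult[OF e(1) that(2) b(2) that(1)] e(2) category(8)[OF that(2)]
        add_subgroup_zero[OF comp_subgroup[OF that(2)]]
      by (auto split: if_splits)
    moreover have "y \<in> R" using that comp_subset by blast
    ultimately show ?thesis
      using that add_subgroup_diff[OF comp_subgroup] by (simp add: left_diff_distrib u_left)
  qed
  have "part (a * y) g \<in> ?T" if a: "a = u - b" and y: "y \<in> R" for a y g
  proof -
    have eq: "a * y = (\<Sum>h | part y h \<noteq> 0. a * part y h)"
      by (subst (1) sum_hpart[OF y, symmetric]) (simp add: sum_distrib_left)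
    have "a * part y h \<in> ?T \<and> (\<exists>k\<in>Mor \<Gamma>. a * part y h \<in> C k)" if "part y h \<noteq> 0" for h
      using that hpart_outside[OF y, of h] hpart_in[OF y, of h] comp_subset[of h] deg a by blast
    then show ?thesis unfolding eq by (intro hpart_in_if_sum[OF sub TR]) simp
  qed
  then have gr: "gr_right_ideal \<Gamma> R C ?T"
    unfolding gr_right_ideal_iff_part using ri by blast
  have "?T = R"
  proof (rule ccontr)
    assume "?T \<noteq> R"
    then obtain U where U: "gr_maximal \<Gamma> R C U" "?T \<subseteq> U" by (rule ex_gr_maximal[OF gr])
    \<comment> \<open>\<open>U\<close> contains \<open>b\<close> from the radical and
      \<open>u - b = (u - b) * u\<close> from \<open>?T\<close>; their sum \<open>u\<close> would
      make \<open>U\<close> all of \<open>R\<close>.\<close>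
    have "b \<in> U" using b U by (auto simp: rad_gr_def)
    moreover have "u - b \<in> U" using U(2) u_in u_right[OF ubR] by (metis image_eqI subsetD)
    moreover have rU: "right_ideal R U" using U(1) by (auto simp: gr_maximal_def gr_right_ideal_def)
    ultimately have "u \<in> U"
      using add_subgroup_add[of U "u - b" b] by (simp add: right_ideal_def)
    then show False using gr_right_ideal_eq_R[OF rU] U(1) by (simp add: gr_maximal_def)
  qed
  then show thesis using u_in that by (metis imageE)
qed

section \<open>Constructions of graded right ideals\<close>

lemma gr_right_ideal_ideal_prod:
  assumes U: "gr_right_ideal \<Gamma> R C U" and V: "gr_right_ideal \<Gamma> R C V"
  shows "gr_right_ideal \<Gamma> R C (ideal_prod U V)"
proof -
  have UR: "U \<subseteq> R" "V \<subseteq> R" using U V by (auto simp: gr_right_ideal_def right_ideal_def)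
  have PR: "ideal_prod U V \<subseteq> R"
    by (rule ideal_prod_subsetI[OF subgroup]) (use UR mult_closed in blast)
  have "x * s \<in> ideal_prod U V" if s: "s \<in> R" and "x \<in> ideal_prod U V" for x s
  proof -
    have "ideal_prod U V \<subseteq> {x. x * s \<in> ideal_prod U V}"
    proof (rule ideal_prod_subsetI[OF add_subgroup_right_mult[OF add_subgroup_ideal_prod]])
      fix a b assume "a \<in> U" "b \<in> V"
      then have "a * (b * s) \<in> ideal_prod U V"
        using V s by (intro mult_in_ideal_prod) (auto simp: gr_right_ideal_def right_ideal_def)
      then show "a * b \<in> {x. x * s \<in> ideal_prod U V}" by (simp add: mult.assoc)
    qed
    then show ?thesis using that by blast
  qed
  moreover have "ideal_prod U V \<subseteq> {x \<in> R. \<forall>g\<in>Mor \<Gamma>. part x g \<in> ideal_prod U V}"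
  proof (rule ideal_prod_subsetI[OF subgroup_hpart_in[OF add_subgroup_ideal_prod]])
    fix a b assume a: "a \<in> U" and b: "b \<in> V"
    then have aR: "a \<in> R" "b \<in> R" using UR by auto
    \<comment> \<open>\<open>a * b\<close> is the double sum of products of components, which lie in
      \<open>ideal_prod U V\<close> because \<open>U\<close> and \<open>V\<close> are closed under
      components.\<close>
    let ?K = "{g. part a g \<noteq> 0} \<times> {g. part b g \<noteq> 0}"
    let ?f = "\<lambda>(g, h). part a g * part b h"
    have eq: "a * b = sum ?f ?K"
      by (subst sum_hpart[OF aR(1), symmetric], subst sum_hpart[OF aR(2), symmetric])
        (simp add: sum_product sum.cartesian_product)
    have "?f p \<in> ideal_prod U V \<and> (\<exists>k\<in>Mor \<Gamma>. ?f p \<in> C k)" if p: "p \<in> ?K" for p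
    proof -
      obtain g h where gh: "p = (g, h)" by (cases p)
      then have mor: "g \<in> Mor \<Gamma>" "h \<in> Mor \<Gamma>" using p aR hpart_outside by auto
      have "part a g * part b h \<in> ideal_prod U V"
        using U V a b mor by (intro mult_in_ideal_prod) (auto simp: gr_right_ideal_iff_part)
      \<comment> \<open>If the degrees do not compose, the product is zero and \<open>g\<close>
        itself serves as its degree.\<close>
      moreover have "\<exists>k\<in>Mor \<Gamma>. part a g * part b h \<in> C k"
        using comp_mult[OF mor hpart_in[OF aR(1) mor(1)] hpart_in[OF aR(2) mor(2)]]
          cmp_closed(1)[OF mor] mor(1) add_subgroup_zero[OF comp_subgroup[OF mor(1)]]
        by (metis (no_types))
      ultimately show ?thesis by (simp add: gh)
    qed
    then have "part (a * b) g \<in> ideal_prod U V" for g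
      unfolding eq by (rule hpart_in_if_sum[OF add_subgroup_ideal_prod PR])
    then show "a * b \<in> {x \<in> R. \<forall>g\<in>Mor \<Gamma>. part x g \<in> ideal_prod U V}"
      using aR mult_closed by blast
  qed
  ultimately show ?thesis
    unfolding gr_right_ideal_iff_part right_ideal_def using PR add_subgroup_ideal_prod by blast
qed

lemma gr_right_ideal_pow:
  "gr_right_ideal \<Gamma> R C U \<Longrightarrow> gr_right_ideal \<Gamma> R C (ideal_pow_Suc U n)"
  by (induction n) (auto intro: gr_right_ideal_ideal_prod)

text \<open>For a right ideal, \<open>ideal_prod U U \<subseteq> U\<close>; multiplying by
  \<open>U\<close> on the right propagates the inclusion.\<close>

lemma ideal_pow_antimono:
  assumes "right_ideal R U"
  shows "ideal_pow_Suc U (Suc n) \<subseteq> ideal_pow_Suc U n"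
proof -
  have mono: "ideal_prod V U \<subseteq> ideal_prod W U" if "V \<subseteq> W" for V W
    using that by (intro ideal_prod_subsetI add_subgroup_ideal_prod mult_in_ideal_prod) auto
  show ?thesis
  proof (induction n)
    case 0
    show ?case
      unfolding ideal_pow_Suc.simps
      by (rule ideal_prod_subsetI) (use assms in \<open>auto simp: right_ideal_def\<close>)
  next
    case (Suc n)
    then show ?case using mono by simp
  qed
qed

text \<open>A homogeneous \<open>k\<close> sends homogeneous elements to homogeneous ones or to
  zero, so \<open>k * y\<close> is a sum of homogeneous elements of the image.\<close>

lemma gr_right_ideal_left_mult:
  assumes U: "gr_right_ideal \<Gamma> R C U" and k: "k \<in> C g" "g \<in> Mor \<Gamma>"
  shows "gr_right_ideal \<Gamma> R C ((*) k ` U)"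
proof -
  have rU: "add_subgroup U" "U \<subseteq> R" "\<And>x s. x \<in> U \<Longrightarrow> s \<in> R \<Longrightarrow> x * s \<in> U"
    using U by (auto simp: gr_right_ideal_def right_ideal_def)
  have kR: "k \<in> R" using k comp_subset by blast
  have sub: "add_subgroup ((*) k ` U)"
    unfolding add_subgroup_def using rU(1)
    by (auto simp: add_subgroup_def image_iff simp flip: distrib_left mult_minus_right)
      (metis mult_zero_right)
  have KR: "(*) k ` U \<subseteq> R" using kR mult_closed rU(2) by blast
  have "part (k * y) h \<in> (*) k ` U" if y: "y \<in> U" for y h
  proof -
    have yR: "y \<in> R" using y rU by blast
    have eq: "k * y = (\<Sum>h | part y h \<noteq> 0. k * part y h)"
      by (subst (1) sum_hpart[OF yR, symmetric]) (simp add: sum_distrib_left)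
    have "k * part y h \<in> (*) k ` U \<and> (\<exists>j\<in>Mor \<Gamma>. k * part y h \<in> C j)"
      if "part y h \<noteq> 0" for h
    proof -
      have h: "h \<in> Mor \<Gamma>" using that hpart_outside[OF yR] by blast
      have "part y h \<in> U" using U y h by (auto simp: gr_right_ideal_iff_part)
      moreover have "\<exists>j\<in>Mor \<Gamma>. k * part y h \<in> C j"
        using comp_mult[OF k(2) h k(1) hpart_in[OF yR h]] cmp_closed(1)[OF k(2) h] k(2)
          add_subgroup_zero[OF comp_subgroup[OF k(2)]]
        by (metis (no_types))
      ultimately show ?thesis by blast
    qed
    then show ?thesis unfolding eq by (intro hpart_in_if_sum[OF sub KR]) simp
  qed
  then show ?thesis
    unfolding gr_right_ideal_iff_part right_ideal_def using sub KR rU(3) by (auto simp: mult.assoc)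
qed

text \<open>Compare the components of degree \<open>g\<close> in \<open>k = k * b\<close>: by
  cancellation in the groupoid, a nonzero \<open>k * part b h\<close> has degree \<open>g\<close>
  only if \<open>h = dm \<Gamma> g\<close>.\<close>

lemma homogeneous_fixed:
  assumes k: "k \<in> C g" "g \<in> Mor \<Gamma>" and b: "b \<in> R" "k = k * b"
  shows "k = k * part b (dm \<Gamma> g)"
proof -
  \<comment> \<open>Inserting \<open>dm \<Gamma> g\<close> keeps this index in the sum even if the
    component of \<open>b\<close> there vanishes.\<close>
  let ?K = "insert (dm \<Gamma> g) {h. part b h \<noteq> 0}"
  have K: "finite ?K" using b finite_hpart by simp
  have kR: "k \<in> R" using k comp_subset by blast
  have partR: "part b h \<in> R" for h
    using hpart_in[OF b(1)] comp_subset hpart_outside[OF b(1)] add_subgroup_zero[OF subgroup]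
    by (metis subsetD)
  have part_k: "part (k * part b h) g = (if h = dm \<Gamma> g then k * part b h else 0)" for h
  proof (cases "h \<in> Mor \<Gamma> \<and> dm \<Gamma> g = rg \<Gamma> h")
    case True
    then have in_C: "k * part b h \<in> C (cmp \<Gamma> g h)"
      using comp_mult[OF k(2) _ k(1) hpart_in[OF b(1)]] by simp
    have "cmp \<Gamma> g h = g \<longleftrightarrow> h = dm \<Gamma> g"
      using inv_mor_cancel_left[OF k(2), of h] True category(7)[OF k(2)] inv_mor(4)[OF k(2)] by metis
    then show ?thesis
      using hpart_homogeneous[OF cmp_closed(1)[OF k(2)] in_C] True by auto
  next
    case False
    then have "k * part b h = 0"
      using comp_mult[OF k(2) _ k(1) hpart_in[OF b(1)], of h] hpart_outside[OF b(1), of h]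
      by (cases "h \<in> Mor \<Gamma>") auto
    then have "part (k * part b h) g = 0" "k * part b h = 0" by (simp_all add: hpart_zero)
    then show ?thesis by (simp only: if_cancel)
  qed
  have "k * b = (\<Sum>h\<in>?K. k * part b h)"
  proof -
    have "(\<Sum>h\<in>?K. part b h) = (\<Sum>h | part b h \<noteq> 0. part b h)"
      using K by (intro sum.mono_neutral_right) auto
    then show ?thesis using sum_hpart[OF b(1)] by (metis sum_distrib_left)
  qed
  then have "part k g = (\<Sum>h\<in>?K. part (k * part b h) g)"
    using hpart_sum[of ?K "\<lambda>h. k * part b h" g] b(2) mult_closed[OF kR partR] by simp
  also have "\<dots> = k * part b (dm \<Gamma> g)"
    unfolding part_k by (subst sum.delta[OF K]) simp
  finally show ?thesis using hpart_homogeneous[OF k(2,1)] by simp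
qed

lemma rad_nilpotent:
  assumes artinian: "right_gr_artinian \<Gamma> R C"
  obtains n where "ideal_pow_Suc (rad_gr \<Gamma> R C) n = {0}"
proof -
  let ?N = "rad_gr \<Gamma> R C"
  let ?gr = "gr_right_ideal \<Gamma> R C"
  note dcc = artinian[unfolded right_gr_artinian_def]
  note grpow = gr_right_ideal_pow[OF gr_right_ideal_rad]
  have riN: "right_ideal R ?N" using gr_right_ideal_rad by (simp add: gr_right_ideal_def)
  obtain n where n: "\<And>m. n \<le> m \<Longrightarrow> ideal_pow_Suc ?N m = ideal_pow_Suc ?N n"
    using no_descending_chain_stable[of ?gr "ideal_pow_Suc ?N", OF dcc grpow ideal_pow_antimono[OF riN]]
    by blast
  define B where "B = ideal_pow_Suc ?N n"
  have grB: "?gr B" using grpow by (simp add: B_def)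
  have riB: "add_subgroup B" "B \<subseteq> R" using grB by (auto simp: gr_right_ideal_def right_ideal_def)
  \<comment> \<open>The product has index \<open>Suc (n + n)\<close>, which is in the range where
    the powers have stabilised.\<close>
  have BB: "ideal_prod B B = B" using ideal_prod_pow[of ?N n n] n[of "Suc (n + n)"] by (simp add: B_def)
  have "B \<subseteq> ?N"
    using lift_Suc_antimono_le[of "ideal_pow_Suc ?N" 0 n, OF ideal_pow_antimono[OF riN]]
    by (simp add: B_def)
  have "B = {0}"
  proof (rule ccontr)
    assume "B \<noteq> {0}"
    \<comment> \<open>If all products \<open>k * b * c\<close> vanished, \<open>k\<close> would
      annihilate \<open>ideal_prod B B = B\<close>. This will show that \<open>k B\<close> is again
      not annihilated by \<open>B\<close>.\<close>
    have ann: "\<exists>b\<in>B. \<exists>c\<in>B. k * b * c \<noteq> 0" if "b \<in> B" "k * b \<noteq> 0" for k b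
    proof (rule ccontr)
      assume "\<not> ?thesis"
      then have "ideal_prod B B \<subseteq> {x. k * x \<in> {0}}"
        by (intro ideal_prod_subsetI add_subgroup_left_mult) (auto simp: add_subgroup_def mult.assoc)
      then show False using that BB by auto
    qed
    \<comment> \<open>\<open>R\<close> itself is a candidate, since \<open>u * b = b\<close>; so a
      minimal candidate exists.\<close>
    have "\<exists>k\<in>R. \<exists>b\<in>B. k * b \<noteq> 0"
    proof -
      obtain b where "b \<in> B" "b \<noteq> 0" using \<open>B \<noteq> {0}\<close> add_subgroup_zero[OF riB(1)] by blast
      then show ?thesis using u_in u_left[of b] riB by (metis subsetD)
    qed
    from no_descending_chain_min[OF dcc gr_right_ideal_R, of "\<lambda>K. \<exists>k\<in>K. \<exists>b\<in>B. k * b \<noteq> 0", OF this]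
    obtain K where K: "?gr K" "\<exists>k\<in>K. \<exists>b\<in>B. k * b \<noteq> 0"
      and min: "\<And>W. ?gr W \<Longrightarrow> \<exists>k\<in>W. \<exists>b\<in>B. k * b \<noteq> 0 \<Longrightarrow> W \<subseteq> K \<Longrightarrow> W = K"
      by metis
    obtain k0 b where kb: "k0 \<in> K" "b \<in> B" "k0 * b \<noteq> 0" using K by blast
    have KR: "K \<subseteq> R" using K(1) by (auto simp: gr_right_ideal_def right_ideal_def)
    then have k0R: "k0 \<in> R" using kb by blast
    \<comment> \<open>Some homogeneous component of \<open>k0\<close> fails to annihilate
      \<open>b\<close>. It replaces \<open>k0\<close>, so that \<open>k B\<close> is graded.\<close>
    have "k0 * b = (\<Sum>g | part k0 g \<noteq> 0. part k0 g * b)"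
      by (subst (1) sum_hpart[OF k0R, symmetric]) (simp add: sum_distrib_right)
    then obtain g where g: "part k0 g \<noteq> 0" "part k0 g * b \<noteq> 0"
      using kb(3) by (metis (mono_tags, lifting) mem_Collect_eq sum.neutral)
    define k where "k = part k0 g"
    have gM: "g \<in> Mor \<Gamma>" using g hpart_outside[OF k0R] by blast
    have k: "k \<in> C g" "k \<in> K" "k * b \<noteq> 0"
      using hpart_in[OF k0R gM] K(1) kb gM g by (auto simp: k_def gr_right_ideal_iff_part)
    have "(*) k ` B = K"
    proof (rule min)
      show "?gr ((*) k ` B)" by (rule gr_right_ideal_left_mult[OF grB k(1) gM])
      show "\<exists>x\<in>(*) k ` B. \<exists>b\<in>B. x * b \<noteq> 0" using ann[OF kb(2) k(3)] by blast
      show "(*) k ` B \<subseteq> K" using k(2) K(1) riB by (auto simp: gr_right_ideal_def right_ideal_def)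
    qed
    \<comment> \<open>\<open>k\<close> lies in \<open>K = k B\<close>, so some \<open>c\<close> in
      \<open>B\<close> satisfies \<open>k = k * c\<close>; by comparison of degrees its component
      \<open>e\<close> already does.\<close>
    then obtain c where c: "c \<in> B" "k = k * c" using k(2) by blast
    define e where "e = part c (dm \<Gamma> g)"
    have cR: "c \<in> R" using c riB by blast
    have ke: "k = k * e" unfolding e_def by (rule homogeneous_fixed[OF k(1) gM cR c(2)])
    have "e \<in> B" using grB c category(1)[OF gM] by (auto simp: e_def gr_right_ideal_iff_part)
    then have "e \<in> ?N" using \<open>B \<subseteq> ?N\<close> by blast
    moreover have "e \<in> C (dm \<Gamma> g)" unfolding e_def by (rule hpart_in[OF cR category(1)[OF gM]])
    ultimately obtain x where x: "x \<in> R" "(u - e) * x = u"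
      using rad_quasi_regular category(1,3)[OF gM] by blast
    have kR: "k \<in> R" using k KR by blast
    \<comment> \<open>Multiplying by the right inverse \<open>x\<close> of \<open>u - e\<close>
      leaves \<open>k = 0\<close>.\<close>
    have "k * (u - e) = 0" using ke u_right[OF kR] by (simp add: right_diff_distrib)
    then have "k * ((u - e) * x) = 0" by (simp flip: mult.assoc)
    then have "k = 0" using x u_right[OF kR] by simp
    then show False using k(3) by simp
  qed
  then show thesis using that by (simp add: B_def)
qed

end


section \<open>The grading of the matrix ring\<close>

lemma entry_sum: "entry (sum f K) i j = (\<Sum>k\<in>K. entry (f k) i j)"
  by (induction K rule: infinite_finite_induct) (simp_all add: entry_zero entry_plus)

text \<open>The matrix unit at \<open>(i, j)\<close>, scaled by \<open>r\<close> because the type of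
  the entries has no \<open>1\<close>.\<close>

definition munit :: "'a::ring \<Rightarrow> 'i \<Rightarrow> 'i \<Rightarrow> ('i, 'a) fmat" where
  "munit r i j = Fmat (\<lambda>k l. if k = i \<and> l = j then r else 0)"

lemma entry_munit: "entry (munit r i j) k l = (if k = i \<and> l = j then r else 0)"
  unfolding munit_def by (subst entry_Fmat[of "{(i, j)}"]) (auto split: if_splits)

lemma entry_mult_munit:
  "entry (A * munit r j l) i k = (if k = l then entry A i j * r else 0)"
  by (subst entry_times_superset[of "{j}"]) (auto simp: entry_munit split: if_splits)

locale graded_matrix_ring = unital_graded_ring \<Gamma> R C u
  for \<Gamma> :: "('g, 'm) small_cat_scheme" and R :: "'a::ring set" and C u +
  fixes I :: "'i set" and \<Sigma> :: "'i \<Rightarrow> 'g set"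
  assumes matricial: "fully_matricial \<Gamma> C I \<Sigma>"
begin

abbreviation "M \<equiv> mat_carrier R I"
abbreviation "MC \<equiv> mat_comp \<Gamma> R C I \<Sigma>"

section \<open>Degrees belonging to a matrix position\<close>

lemma sigma_Mor: "i \<in> I \<Longrightarrow> s \<in> \<Sigma> i \<Longrightarrow> s \<in> Mor \<Gamma>"
  and sigma_dm: "i \<in> I \<Longrightarrow> s \<in> \<Sigma> i \<Longrightarrow> t \<in> \<Sigma> i \<Longrightarrow> dm \<Gamma> s = dm \<Gamma> t \<Longrightarrow> s = t"
  and sigma_bij: "i \<in> I \<Longrightarrow> bij_betw (rg \<Gamma>) (\<Sigma> i) (Idm' \<Gamma> C)"
  and finite_rows: "e \<in> Idm \<Gamma> \<Longrightarrow> finite {i \<in> I. \<exists>s\<in>\<Sigma> i. dm \<Gamma> s = e}"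
  using matricial unfolding fully_matricial_def by (auto simp: inj_on_def)

lemma sigma_rg: "i \<in> I \<Longrightarrow> s \<in> \<Sigma> i \<Longrightarrow> t \<in> \<Sigma> i \<Longrightarrow> rg \<Gamma> s = rg \<Gamma> t \<Longrightarrow> s = t"
  using sigma_bij by (auto simp: bij_betw_def inj_on_def)

text \<open>Membership of \<open>d\<close> in
  \<open>\<Sigma>\<^sub>i g \<Sigma>\<^sub>j\<^sup>-\<^sup>1\<close>: the degree in \<open>R\<close>
  required of entry \<open>(i, j)\<close> of a matrix of degree \<open>g\<close>. It is a relation
  because this set may be empty.\<close>

definition conn :: "'i \<Rightarrow> 'i \<Rightarrow> 'g \<Rightarrow> 'g \<Rightarrow> bool" where
  "conn i j g d \<longleftrightarrow> g \<in> Mor \<Gamma> \<and> (\<exists>s\<in>\<Sigma> i. \<exists>t\<in>\<Sigma> j. dm \<Gamma> s = rg \<Gamma> g \<and> dm \<Gamma> t = dm \<Gamma> g \<and>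
     d = cmp \<Gamma> (cmp \<Gamma> s g) (inv_mor \<Gamma> t))"

lemma connE:
  assumes "conn i j g d" "i \<in> I" "j \<in> I"
  obtains s t where "g \<in> Mor \<Gamma>" "s \<in> \<Sigma> i" "t \<in> \<Sigma> j" "dm \<Gamma> s = rg \<Gamma> g" "dm \<Gamma> t = dm \<Gamma> g"
    "d = cmp \<Gamma> (cmp \<Gamma> s g) (inv_mor \<Gamma> t)" "d \<in> Mor \<Gamma>" "rg \<Gamma> d = rg \<Gamma> s" "dm \<Gamma> d = rg \<Gamma> t"
proof -
  obtain s t where st: "g \<in> Mor \<Gamma>" "s \<in> \<Sigma> i" "t \<in> \<Sigma> j" "dm \<Gamma> s = rg \<Gamma> g" "dm \<Gamma> t = dm \<Gamma> g"
    "d = cmp \<Gamma> (cmp \<Gamma> s g) (inv_mor \<Gamma> t)"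
    using assms(1) unfolding conn_def by blast
  moreover have "s \<in> Mor \<Gamma>" "t \<in> Mor \<Gamma>" using st sigma_Mor assms by auto
  ultimately show thesis using that[OF st] by (simp add: cmp_closed inv_mor)
qed

lemma cmp_set_conn:
  assumes "i \<in> I" "j \<in> I" "g \<in> Mor \<Gamma>"
  shows "cmp_set \<Gamma> (cmp_set \<Gamma> (\<Sigma> i) {g}) (inv_set \<Gamma> (\<Sigma> j)) = {d. conn i j g d}"
proof -
  have *: "dm \<Gamma> (cmp \<Gamma> s g) = dm \<Gamma> g" "rg \<Gamma> (inv_mor \<Gamma> t) = dm \<Gamma> t"
    if "s \<in> \<Sigma> i" "t \<in> \<Sigma> j" "dm \<Gamma> s = rg \<Gamma> g" for s t
    using that assms sigma_Mor by (simp_all add: cmp_closed inv_mor)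
  have "d \<in> cmp_set \<Gamma> (cmp_set \<Gamma> (\<Sigma> i) {g}) (inv_set \<Gamma> (\<Sigma> j)) \<longleftrightarrow>
    (\<exists>s\<in>\<Sigma> i. \<exists>t\<in>\<Sigma> j. dm \<Gamma> s = rg \<Gamma> g \<and> dm \<Gamma> (cmp \<Gamma> s g) = rg \<Gamma> (inv_mor \<Gamma> t) \<and>
      d = cmp \<Gamma> (cmp \<Gamma> s g) (inv_mor \<Gamma> t))" for d
    unfolding cmp_set_def inv_set_def by blast
  then have "d \<in> cmp_set \<Gamma> (cmp_set \<Gamma> (\<Sigma> i) {g}) (inv_set \<Gamma> (\<Sigma> j)) \<longleftrightarrow> conn i j g d" for d
    unfolding conn_def using * assms(3) by metis
  then show ?thesis by blast
qed

text \<open>Injectivity of \<open>dm\<close> on \<open>\<Sigma> i\<close> and on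
  \<open>\<Sigma> j\<close> fixes \<open>s\<close> and \<open>t\<close>.\<close>

lemma conn_unique:
  assumes "i \<in> I" "j \<in> I" "conn i j g d" "conn i j g d'"
  shows "d = d'"
  using assms sigma_dm unfolding conn_def by metis

text \<open>The range and domain of \<open>d\<close> are the ranges of \<open>s\<close> and
  \<open>t\<close>, so injectivity of \<open>rg\<close> fixes both; then
  \<open>g = s\<^sup>-\<^sup>1 d t\<close>.\<close>

lemma conn_inj:
  assumes I: "i \<in> I" "j \<in> I" and "conn i j g d" "conn i j h d"
  shows "g = h"
proof -
  obtain s t where 1: "g \<in> Mor \<Gamma>" "s \<in> \<Sigma> i" "t \<in> \<Sigma> j" "dm \<Gamma> s = rg \<Gamma> g" "dm \<Gamma> t = dm \<Gamma> g"
    "d = cmp \<Gamma> (cmp \<Gamma> s g) (inv_mor \<Gamma> t)" "rg \<Gamma> d = rg \<Gamma> s" "dm \<Gamma> d = rg \<Gamma> t"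
    using connE[OF assms(3) I] by metis
  obtain s' t' where 2: "h \<in> Mor \<Gamma>" "s' \<in> \<Sigma> i" "t' \<in> \<Sigma> j" "dm \<Gamma> s' = rg \<Gamma> h" "dm \<Gamma> t' = dm \<Gamma> h"
    "d = cmp \<Gamma> (cmp \<Gamma> s' h) (inv_mor \<Gamma> t')" "rg \<Gamma> d = rg \<Gamma> s'" "dm \<Gamma> d = rg \<Gamma> t'"
    using connE[OF assms(4) I] by metis
  have st: "s' = s" "t' = t" using 1 2 sigma_rg I by metis+
  have mor: "s \<in> Mor \<Gamma>" "t \<in> Mor \<Gamma>" using 1 sigma_Mor I by auto
  have "k = cmp \<Gamma> (inv_mor \<Gamma> s) (cmp \<Gamma> d t)"
    if "k \<in> Mor \<Gamma>" "dm \<Gamma> s = rg \<Gamma> k" "dm \<Gamma> t = dm \<Gamma> k"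
      "d = cmp \<Gamma> (cmp \<Gamma> s k) (inv_mor \<Gamma> t)" for k
    using that mor by (simp add: inv_mor_cancel_right inv_mor_cancel_left cmp_closed)
  then show ?thesis using 1 2 st by metis
qed

text \<open>Surjectivity of \<open>rg\<close> onto \<open>Idm' \<Gamma> C\<close> supplies
  \<open>s\<close> and \<open>t\<close>; solving \<open>s g t\<^sup>-\<^sup>1 = d\<close> gives
  \<open>g = s\<^sup>-\<^sup>1 d t\<close>.\<close>

lemma conn_surj:
  assumes I: "i \<in> I" "j \<in> I" and d: "d \<in> Mor \<Gamma>" "rg \<Gamma> d \<in> Idm' \<Gamma> C" "dm \<Gamma> d \<in> Idm' \<Gamma> C"
  obtains g where "conn i j g d"
proof -
  obtain s t where st: "s \<in> \<Sigma> i" "t \<in> \<Sigma> j" "rg \<Gamma> s = rg \<Gamma> d" "rg \<Gamma> t = dm \<Gamma> d"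
    using sigma_bij I d unfolding bij_betw_def by (metis imageE)
  have mor: "s \<in> Mor \<Gamma>" "t \<in> Mor \<Gamma>" using st sigma_Mor I by auto
  let ?g = "cmp \<Gamma> (inv_mor \<Gamma> s) (cmp \<Gamma> d t)"
  have dt: "cmp \<Gamma> d t \<in> Mor \<Gamma>" "rg \<Gamma> (cmp \<Gamma> d t) = rg \<Gamma> d" "dm \<Gamma> (cmp \<Gamma> d t) = dm \<Gamma> t"
    using d st mor by (simp_all add: cmp_closed)
  have g: "?g \<in> Mor \<Gamma>" "rg \<Gamma> ?g = dm \<Gamma> s" "dm \<Gamma> ?g = dm \<Gamma> t"
    using dt st mor by (simp_all add: cmp_closed inv_mor)
  have "cmp \<Gamma> s ?g = cmp \<Gamma> (cmp \<Gamma> s (inv_mor \<Gamma> s)) (cmp \<Gamma> d t)"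
    using mor dt st by (intro cmp_assoc[symmetric]) (simp_all add: inv_mor)
  also have "\<dots> = cmp \<Gamma> d t" using mor dt st category(8)[of "cmp \<Gamma> d t"] by (simp add: inv_mor)
  finally have "cmp \<Gamma> (cmp \<Gamma> s ?g) (inv_mor \<Gamma> t) = cmp \<Gamma> (cmp \<Gamma> d t) (inv_mor \<Gamma> t)" by simp
  also have "\<dots> = cmp \<Gamma> d (cmp \<Gamma> t (inv_mor \<Gamma> t))"
    using mor d st by (intro cmp_assoc) (simp_all add: inv_mor)
  also have "\<dots> = d" using mor d st category(7)[of d] by (simp add: inv_mor)
  finally have "conn i j ?g d" unfolding conn_def using g st by metis
  then show thesis by (rule that)
qed

lemma Idm_identity:
  assumes "e \<in> Idm \<Gamma>"
  shows "identity_of (C e) \<in> C e"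
proof -
  obtain v where v: "is_identity (C e) v" using graded_ring assms unfolding graded_ring_def by blast
  have "w = v" if "is_identity (C e) w" for w using v that unfolding is_identity_def by metis
  then have "is_identity (C e) (identity_of (C e))" unfolding identity_of_def using v by (rule theI[rotated])
  then show ?thesis by (simp add: is_identity_def)
qed

lemma identity_mult:
  assumes "g \<in> Mor \<Gamma>" "a \<in> C g"
  shows "identity_of (C (rg \<Gamma> g)) * a = a" "a * identity_of (C (dm \<Gamma> g)) = a"
  using graded_ring assms unfolding graded_ring_def by blast+

text \<open>The identities at both ends of \<open>d\<close> fix \<open>a \<noteq> 0\<close>, hence
  are nonzero, and \<open>conn_surj\<close> applies. So every nonzero homogeneous element of
  \<open>R\<close> can occur at every position.\<close>

lemma nonzero_conn:
  assumes "i \<in> I" "j \<in> I" "d \<in> Mor \<Gamma>" "a \<in> C d" "a \<noteq> 0"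
  obtains g where "conn i j g d"
proof (rule conn_surj[OF assms(1-3)])
  show "rg \<Gamma> d \<in> Idm' \<Gamma> C" "dm \<Gamma> d \<in> Idm' \<Gamma> C"
    using identity_mult[OF assms(3,4)] assms(3,5) unfolding Idm'_def Idm_def
    by (auto simp: category)
qed

text \<open>By uniqueness the degree set is empty or a singleton, the only cases in which
  \<open>comp_at\<close> is meaningful.\<close>

lemma mat_comp_iff:
  assumes "g \<in> Mor \<Gamma>"
  shows "A \<in> MC g \<longleftrightarrow> A \<in> M \<and> (\<forall>i\<in>I. \<forall>j\<in>I. (\<forall>d. conn i j g d \<longrightarrow> entry A i j \<in> C d) \<and>
    ((\<forall>d. \<not> conn i j g d) \<longrightarrow> entry A i j = 0))"
proof -
  have "a \<in> comp_at C {d. conn i j g d} \<longleftrightarrow> (\<forall>d. conn i j g d \<longrightarrow> a \<in> C d) \<and>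
    ((\<forall>d. \<not> conn i j g d) \<longrightarrow> a = 0)" if "i \<in> I" "j \<in> I" for i j a
  proof (cases "\<exists>d. conn i j g d")
    case True
    then obtain d where d: "conn i j g d" by blast
    then have "{d. conn i j g d} = {d}" using conn_unique[OF that] by blast
    then show ?thesis using d conn_unique[OF that] by (auto simp: comp_at_def)
  qed (auto simp: comp_at_def)
  then show ?thesis using assms unfolding mat_comp_def by (simp add: cmp_set_conn)
qed

section \<open>Homogeneous components of a matrix\<close>

lemma entry_in: "A \<in> M \<Longrightarrow> entry A i j \<in> R"
  and entry_outside: "A \<in> M \<Longrightarrow> i \<notin> I \<or> j \<notin> I \<Longrightarrow> entry A i j = 0"
  by (auto simp: mat_carrier_def)

lemma add_subgroup_M: "add_subgroup M"
  using subgroup unfolding mat_carrier_def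
  by (auto simp: add_subgroup_def entry_zero entry_plus entry_uminus)

text \<open>Entry \<open>(i, j)\<close> of the component of degree \<open>g\<close> of any matrix in
  \<open>M\<close> whose entry there is \<open>x\<close>; see \<open>entry_hpart\<close>.\<close>

definition deg_part :: "'a \<Rightarrow> 'i \<Rightarrow> 'i \<Rightarrow> 'g \<Rightarrow> 'a" where
  "deg_part x i j g =
    (if i \<in> I \<and> j \<in> I \<and> (\<exists>d. conn i j g d) then part x (THE d. conn i j g d) else 0)"

lemma The_conn: "i \<in> I \<Longrightarrow> j \<in> I \<Longrightarrow> conn i j g d \<Longrightarrow> (THE d. conn i j g d) = d"
  using conn_unique by blast

lemma deg_part_conn: "i \<in> I \<Longrightarrow> j \<in> I \<Longrightarrow> conn i j g d \<Longrightarrow> deg_part x i j g = part x d"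
  unfolding deg_part_def using The_conn by auto

lemma deg_part_zero: "deg_part 0 i j g = 0"
  by (simp add: deg_part_def hpart_zero)

lemma deg_part_closed:
  assumes "add_subgroup U" "\<forall>g\<in>Mor \<Gamma>. part x g \<in> U"
  shows "deg_part x i j g \<in> U"
proof (cases "i \<in> I \<and> j \<in> I \<and> (\<exists>d. conn i j g d)")
  case True
  then obtain d where "conn i j g d" by blast
  then show ?thesis using True assms(2) connE deg_part_conn by metis
qed (use add_subgroup_zero[OF assms(1)] in \<open>auto simp: deg_part_def\<close>)

text \<open>Injectivity comes from \<open>conn_inj\<close>, surjectivity from
  \<open>nonzero_conn\<close>: at a fixed position, degrees of matrices merely re-index the degrees
  of \<open>x\<close>.\<close>

lemma deg_part_bij:
  assumes "i \<in> I" "j \<in> I" "x \<in> R"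
  shows "bij_betw (\<lambda>g. THE d. conn i j g d) {g. deg_part x i j g \<noteq> 0} {d. part x d \<noteq> 0}"
proof -
  have conn: "\<exists>d. conn i j g d \<and> part x d \<noteq> 0" if "deg_part x i j g \<noteq> 0" for g
    using that assms by (metis deg_part_conn deg_part_def)
  have "d \<in> (\<lambda>g. THE d. conn i j g d) ` {g. deg_part x i j g \<noteq> 0}" if d: "part x d \<noteq> 0" for d
  proof -
    have "d \<in> Mor \<Gamma>" using d hpart_outside[OF assms(3)] by blast
    then obtain g where g: "conn i j g d"
      using nonzero_conn[OF assms(1,2) _ hpart_in[OF assms(3)] d] by blast
    then show ?thesis
      using d by (intro image_eqI[of _ _ g]) (auto simp: The_conn deg_part_conn assms)
  qed
  then show ?thesis
    unfolding bij_betw_def inj_on_def using conn conn_inj The_conn assms(1,2)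
    by (smt (verit, best) image_subsetI mem_Collect_eq subsetI subset_antisym)
qed

lemma finite_deg_part: "x \<in> R \<Longrightarrow> finite {g. deg_part x i j g \<noteq> 0}"
  using deg_part_bij[of i j x] finite_hpart[of x]
  by (cases "i \<in> I \<and> j \<in> I") (auto simp: bij_betw_finite deg_part_def)

lemma sum_deg_part:
  assumes "i \<in> I" "j \<in> I" "x \<in> R"
  shows "(\<Sum>g | deg_part x i j g \<noteq> 0. deg_part x i j g) = x"
proof -
  have "deg_part x i j g = part x (THE d. conn i j g d)" if "deg_part x i j g \<noteq> 0" for g
    using that by (auto simp: deg_part_def split: if_splits)
  then have "(\<Sum>g | deg_part x i j g \<noteq> 0. deg_part x i j g) =
    (\<Sum>g | deg_part x i j g \<noteq> 0. part x (THE d. conn i j g d))" by simp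
  also have "\<dots> = (\<Sum>d | part x d \<noteq> 0. part x d)"
    by (rule sum.reindex_bij_betw[OF deg_part_bij[OF assms]])
  finally show ?thesis using sum_hpart[OF assms(3)] by simp
qed

text \<open>A nonzero entry of \<open>f h\<close> at \<open>(i, j)\<close> is homogeneous of the
  degree linked to \<open>h\<close>. By \<open>conn_inj\<close> only \<open>h = g\<close>
  contributes to the degree linked to \<open>g\<close>, so the decomposition is determined by
  \<open>A\<close>.\<close>

lemma decomposes_entry:
  assumes f: "decomposes (Mor \<Gamma>) MC f A"
  shows "entry (f g) i j = deg_part (entry A i j) i j g"
proof -
  let ?K = "{g. f g \<noteq> 0}"
  have fin: "finite ?K" and A: "A = sum f ?K"
    and f0: "\<And>h. h \<notin> Mor \<Gamma> \<Longrightarrow> f h = 0" and fC: "\<And>h. h \<in> Mor \<Gamma> \<Longrightarrow> f h \<in> MC h"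
    using f by (auto simp: decomposes_def)
  have fM: "f h \<in> M" for h
    using f0[of h] fC[of h] add_subgroup_zero[OF add_subgroup_M] mat_comp_iff[of h] by fastforce
  show ?thesis
  proof (cases "i \<in> I \<and> j \<in> I \<and> (\<exists>d. conn i j g d)")
    case True
    then obtain d where ij: "i \<in> I" "j \<in> I" and d: "conn i j g d" by blast
    have dM: "d \<in> Mor \<Gamma>" using connE[OF d ij] by metis
    have *: "part (entry (f h) i j) d = (if h = g then entry (f h) i j else 0)" for h
    proof (cases "entry (f h) i j = 0")
      case False
      then have h: "h \<in> Mor \<Gamma>" using f0 entry_zero by metis
      then obtain d' where d': "conn i j h d'" "entry (f h) i j \<in> C d'"
        using fC[OF h] mat_comp_iff[OF h] ij False by metis
      have "d' \<in> Mor \<Gamma>" using connE[OF d'(1) ij] by metis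
      then show ?thesis
        using hpart_homogeneous[OF _ d'(2), of d] conn_inj[OF ij d'(1)] conn_unique[OF ij d'(1)] d by auto
    qed (auto simp: hpart_zero)
    have "deg_part (entry A i j) i j g = part (\<Sum>h\<in>?K. entry (f h) i j) d"
      using deg_part_conn[OF ij d] A entry_sum[of f ?K i j] by metis
    also have "\<dots> = (\<Sum>h\<in>?K. if h = g then entry (f h) i j else 0)"
      by (subst hpart_sum) (auto simp: entry_in[OF fM] *)
    also have "\<dots> = entry (f g) i j" using fin by (auto simp: entry_zero)
    finally show ?thesis by simp
  next
    case False
    have "entry (f g) i j = 0"
    proof (cases "g \<in> Mor \<Gamma> \<and> i \<in> I \<and> j \<in> I")
      case True
      then show ?thesis using False fC[of g] mat_comp_iff[of g] by blast
    next
      case False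
      then show ?thesis using f0[of g] entry_outside[OF fM] by (auto simp: entry_zero)
    qed
    then show ?thesis using False by (auto simp: deg_part_def)
  qed
qed

text \<open>Decompose entry by entry. Only finitely many degrees occur: there are finitely many
  nonzero entries, each with finitely many components.\<close>

lemma ex_decomposition:
  assumes A: "A \<in> M"
  shows "\<exists>f. decomposes (Mor \<Gamma>) MC f A"
proof -
  let ?supp = "{(i, j). entry A i j \<noteq> 0}"
  define f where "f g = Fmat (\<lambda>i j. deg_part (entry A i j) i j g)" for g
  have entry_f: "entry (f g) i j = deg_part (entry A i j) i j g" for g i j
    unfolding f_def by (subst entry_Fmat[OF finite_entries[of A]]) (auto simp: deg_part_zero)
  have AR: "entry A i j \<in> R" for i j using entry_in[OF A] .
  let ?K = "\<Union>(i, j)\<in>?supp. {g. deg_part (entry A i j) i j g \<noteq> 0}"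
  have "decomposes (Mor \<Gamma>) MC f A"
  proof (rule decomposesI)
    show "finite ?K"
      by (rule finite_UN_I[OF finite_entries]) (use finite_deg_part[OF AR] in auto)
    show "g \<in> ?K" if g: "f g \<noteq> 0" for g
    proof -
      obtain i j where "entry (f g) i j \<noteq> 0" using g fmat_eqI entry_zero by metis
      then have *: "deg_part (entry A i j) i j g \<noteq> 0" by (simp add: entry_f)
      then have "(i, j) \<in> ?supp" by (auto simp: deg_part_zero)
      then show ?thesis by (rule UN_I) (simp add: *)
    qed
    show "A = sum f ?K"
    proof (rule fmat_eqI)
      fix i j
      show "entry A i j = entry (sum f ?K) i j"
      proof (cases "entry A i j = 0")
        case True
        then show ?thesis by (simp add: entry_sum entry_f deg_part_zero)
      next
        case False
        then have ij: "i \<in> I" "j \<in> I" using entry_outside[OF A] by auto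
        have "(\<Sum>g\<in>?K. deg_part (entry A i j) i j g) =
          (\<Sum>g | deg_part (entry A i j) i j g \<noteq> 0. deg_part (entry A i j) i j g)"
          using False \<open>finite ?K\<close> by (intro sum.mono_neutral_right) auto
        then show ?thesis using sum_deg_part[OF ij AR] by (simp add: entry_sum entry_f)
      qed
    qed
    show "f g = 0" if "g \<notin> Mor \<Gamma>" for g
      using that by (intro fmat_eqI) (auto simp: entry_f entry_zero deg_part_def conn_def)
    show "f g \<in> MC g" if g: "g \<in> Mor \<Gamma>" for g
    proof -
      have "deg_part (entry A i j) i j g \<in> R" for i j
        by (rule deg_part_closed[OF subgroup]) (use hpart_in[OF AR] comp_subset in blast)
      then have "f g \<in> M" by (auto simp: mat_carrier_def entry_f deg_part_def)
      moreover have "entry (f g) i j \<in> C d" if "i \<in> I" "j \<in> I" "conn i j g d" for i j d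
      proof -
        have "d \<in> Mor \<Gamma>" using connE[OF that(3,1,2)] by metis
        then show ?thesis using hpart_in[OF AR] by (simp add: entry_f deg_part_conn[OF that])
      qed
      ultimately show ?thesis
        unfolding mat_comp_iff[OF g] by (auto simp: entry_f deg_part_def)
    qed
  qed
  then show ?thesis by blast
qed

lemma direct_sum_M: "direct_sum (Mor \<Gamma>) MC M"
  unfolding direct_sum_iff
proof (intro conjI ballI add_subgroup_M)
  fix g assume g: "g \<in> Mor \<Gamma>"
  show "MC g \<subseteq> M" unfolding mat_comp_def by blast
  have "add_subgroup (C d)" if "i \<in> I" "j \<in> I" "conn i j g d" for i j d
    using connE[OF that(3,1,2)] comp_subgroup by metis
  then have "0 \<in> C d" "x \<in> C d \<Longrightarrow> y \<in> C d \<Longrightarrow> x + y \<in> C d" "x \<in> C d \<Longrightarrow> - x \<in> C d"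
    if "i \<in> I" "j \<in> I" "conn i j g d" for i j d x y
    using that unfolding add_subgroup_def by blast+
  then show "add_subgroup (MC g)"
    using add_subgroup_M unfolding add_subgroup_def
    by (auto simp: mat_comp_iff[OF g] entry_zero entry_plus entry_uminus)
next
  fix A assume A: "A \<in> M"
  show "\<exists>!f. decomposes (Mor \<Gamma>) MC f A"
  proof (rule ex_ex1I[OF ex_decomposition[OF A]])
    fix f f' assume "decomposes (Mor \<Gamma>) MC f A" "decomposes (Mor \<Gamma>) MC f' A"
    then show "f = f'" by (intro ext fmat_eqI) (simp add: decomposes_entry)
  qed
qed

sublocale M: grading "Mor \<Gamma>" MC M
  by (rule grading.intro[OF direct_sum_M])

lemma entry_hpart:
  "A \<in> M \<Longrightarrow> entry (hpart (Mor \<Gamma>) MC A g) i j = deg_part (entry A i j) i j g"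
  by (rule decomposes_entry[OF M.decomposes_hpart])

lemma gr_right_ideal_M_iff:
  "gr_right_ideal \<Gamma> M MC U \<longleftrightarrow>
    right_ideal M U \<and> (\<forall>x\<in>U. \<forall>g\<in>Mor \<Gamma>. hpart (Mor \<Gamma>) MC x g \<in> U)"
  by (rule gr_right_ideal_iff[OF direct_sum_M])


section \<open>Rows of right ideals of matrices\<close>

text \<open>Row \<open>i\<close> of \<open>A * B\<close> is made of right linear combinations of the
  entries in row \<open>i\<close> of \<open>A\<close>, so conditions on a single row can define
  right ideals.\<close>

lemma mult_entry_closed:
  assumes "right_ideal R U" "B \<in> M" "\<And>k. entry A i k \<in> U"
  shows "entry (A * B) i j \<in> U"
  unfolding entry_times
  using assms entry_in[of B] by (intro add_subgroup_sum) (auto simp: right_ideal_def)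

lemma M_mult_closed:
  assumes "A \<in> M" "B \<in> M"
  shows "A * B \<in> M"
proof -
  have "right_ideal R R" using gr_right_ideal_R by (simp add: gr_right_ideal_def)
  then have "entry (A * B) i j \<in> R" for i j using assms entry_in by (intro mult_entry_closed) auto
  moreover have "entry (A * B) i j = 0" if "i \<notin> I \<or> j \<notin> I" for i j
    unfolding entry_times using that assms by (auto simp: entry_outside)
  ultimately show ?thesis by (simp add: mat_carrier_def)
qed

lemma munit_in_M: "r \<in> R \<Longrightarrow> i \<in> I \<Longrightarrow> j \<in> I \<Longrightarrow> munit r i j \<in> M"
  using add_subgroup_zero[OF subgroup] by (auto simp: mat_carrier_def entry_munit)

text \<open>Right multiplication by \<open>munit r j k\<close> moves column \<open>j\<close> to
  column \<open>k\<close>. With \<open>r = u\<close> this shows that the entries of \<open>V\<close>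
  at \<open>(i, j)\<close> form a set independent of \<open>j\<close>.\<close>

lemma column_shift:
  assumes V: "right_ideal M V" and "i \<in> I" "j \<in> I" "k \<in> I" "v \<in> V" "r \<in> R"
  shows "entry v i j * r \<in> (\<lambda>w. entry w i k) ` V"
proof -
  have "v * munit r j k \<in> V" using assms munit_in_M by (auto simp: right_ideal_def)
  then show ?thesis by (rule image_eqI[rotated]) (simp add: entry_mult_munit)
qed

text \<open>A nonzero component of \<open>entry v i j\<close> of degree \<open>d\<close> is the
  entry of a component of \<open>v\<close>, namely that of the degree \<open>g\<close> linked to
  \<open>d\<close>.\<close>

lemma gr_right_ideal_column:
  assumes V: "gr_right_ideal \<Gamma> M MC V" and ij: "i \<in> I" "j \<in> I"
  shows "gr_right_ideal \<Gamma> R C ((\<lambda>v. entry v i j) ` V)" (is "gr_right_ideal _ _ _ ?P")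
proof -
  have rV: "right_ideal M V" "add_subgroup V" "V \<subseteq> M"
    using V by (auto simp: gr_right_ideal_def right_ideal_def)
  have sub: "add_subgroup ?P"
    using rV(2) unfolding add_subgroup_def
    by (auto simp: image_iff simp flip: entry_plus entry_uminus) (metis entry_zero)
  have "?P \<subseteq> R" using rV(3) entry_in by blast
  moreover have "x * r \<in> ?P" if "x \<in> ?P" "r \<in> R" for x r
    using that column_shift[OF rV(1) ij ij(2)] by blast
  ultimately have ri: "right_ideal R ?P" using sub unfolding right_ideal_def by simp
  have hom: "part (entry v i j) d \<in> ?P" if v: "v \<in> V" and d: "d \<in> Mor \<Gamma>" for v d
  proof (cases "part (entry v i j) d = 0")
    case True
    then show ?thesis using add_subgroup_zero[OF sub] by simp
  next
    case False
    have vM: "v \<in> M" using v rV by blast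
    obtain g where g: "conn i j g d"
      using nonzero_conn[OF ij d hpart_in[OF entry_in[OF vM] d] False] .
    have "part (entry v i j) d = entry (hpart (Mor \<Gamma>) MC v g) i j"
      using entry_hpart[OF vM] deg_part_conn[OF ij g] by simp
    moreover have "hpart (Mor \<Gamma>) MC v g \<in> V"
      using V v g unfolding gr_right_ideal_M_iff conn_def by blast
    ultimately show ?thesis by blast
  qed
  show ?thesis
    unfolding gr_right_ideal_iff_part
  proof (intro conjI ri ballI)
    fix x d assume "x \<in> ?P" "d \<in> Mor \<Gamma>"
    then show "part x d \<in> ?P" using hom by (elim imageE) simp
  qed
qed

text \<open>For each \<open>k\<close> an element of \<open>V\<close> has the wanted value at
  \<open>(i, j)\<close>. These elements are moved to their columns by matrix units and summed over
  the finite support of the row.\<close>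

lemma row_in_ideal:
  assumes V: "right_ideal M V" and ij: "i \<in> I" "j \<in> I" and s: "s \<in> M"
    and "\<And>k. entry s i k \<in> (\<lambda>v. entry v i j) ` V"
  obtains w where "w \<in> V" "\<And>k. entry w i k = entry s i k"
proof -
  have "\<exists>v. v \<in> V \<and> entry v i j = entry s i k" for k using assms(5)[of k] by (elim imageE) auto
  then obtain v where v: "\<And>k. v k \<in> V" "\<And>k. entry (v k) i j = entry s i k" by metis
  let ?K = "{k. entry s i k \<noteq> 0}"
  let ?w = "\<Sum>k\<in>?K. v k * munit u j k"
  have "k \<in> I" if "entry s i k \<noteq> 0" for k using that entry_outside[OF s] by blast
  then have "?w \<in> V"
    using V v(1) ij munit_in_M[OF u_in] by (intro add_subgroup_sum) (auto simp: right_ideal_def)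
  moreover have "entry ?w i l = entry s i l" for l
  proof -
    have "entry ?w i l = (\<Sum>k\<in>?K. if l = k then entry s i k * u else 0)"
      unfolding entry_sum by (intro sum.cong) (auto simp: entry_mult_munit v(2))
    also have "\<dots> = entry s i l"
      using finite_row[of s i] u_right[OF entry_in[OF s]] by (auto simp: sum.delta)
    finally show ?thesis .
  qed
  ultimately show thesis by (rule that)
qed


section \<open>The chain condition and the radical of the matrix ring\<close>

text \<open>Induction on the set of nonzero rows: a graded right ideal is determined by its elements
  with vanishing row \<open>i\<close> together with the graded right ideal of \<open>R\<close> formed by the entries in
  row \<open>i\<close>.\<close>

lemma stable_finite_rows:
  assumes "right_gr_artinian \<Gamma> R C" "finite F" "F \<subseteq> I"
    and "\<And>n. gr_right_ideal \<Gamma> M MC (U n)" "\<And>n. U (Suc n) \<subseteq> U n"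
    and "\<And>n A i j. A \<in> U n \<Longrightarrow> i \<notin> F \<Longrightarrow> entry A i j = 0"
  shows "\<exists>N. \<forall>m\<ge>N. U m = U N"
  using assms(2-)
proof (induction F arbitrary: U)
  case empty
  have "U n = {0}" for n
  proof -
    have "A = 0" if "A \<in> U n" for A
      using empty(4)[OF that] by (intro fmat_eqI) (simp add: entry_zero)
    moreover have "0 \<in> U n" using empty(2)[of n] by (auto simp: gr_right_ideal_def right_ideal_def add_subgroup_def)
    ultimately show ?thesis by blast
  qed
  then show ?case by blast
next
  case (insert i F)
  have i: "i \<in> I" using insert.prems by blast
  have ri: "right_ideal M (U n)" for n using insert.prems(2) by (auto simp: gr_right_ideal_def)
  have UM: "U n \<subseteq> M" for n using ri by (auto simp: right_ideal_def)
  define V where "V n = U n \<inter> {A. \<forall>j. entry A i j = 0}" for n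
  define W where "W n = (\<lambda>v. entry v i i) ` U n" for n
  have "\<exists>N. \<forall>m\<ge>N. V m = V N"
  proof (rule insert.IH)
    show "gr_right_ideal \<Gamma> M MC (V n)" for n
    proof -
      have "right_ideal M (V n)"
        using ri[of n] unfolding right_ideal_def add_subgroup_def V_def
        by (auto simp: entry_zero entry_plus entry_uminus entry_times)
      moreover have "hpart (Mor \<Gamma>) MC A g \<in> V n" if "A \<in> V n" "g \<in> Mor \<Gamma>" for A g
        using that insert.prems(2)[of n] UM[of n] entry_hpart[of A]
        unfolding V_def gr_right_ideal_M_iff by (auto simp: deg_part_zero)
      ultimately show ?thesis unfolding gr_right_ideal_M_iff by blast
    qed
    show "V (Suc n) \<subseteq> V n" for n using insert.prems(3) by (auto simp: V_def)
    show "entry A k j = 0" if "A \<in> V n" "k \<notin> F" for n A k j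
      using that insert.prems(4)[of A n k j] by (cases "k = i") (auto simp: V_def)
  qed (use insert.prems in auto)
  then obtain N1 where N1: "\<And>m. m \<ge> N1 \<Longrightarrow> V m = V N1" by blast
  have "gr_right_ideal \<Gamma> R C (W n)" for n
    unfolding W_def by (rule gr_right_ideal_column[OF insert.prems(2) i i])
  moreover have "W (Suc n) \<subseteq> W n" for n using insert.prems(3) unfolding W_def by blast
  ultimately obtain N2 where N2: "\<And>m. m \<ge> N2 \<Longrightarrow> W m = W N2"
    using no_descending_chain_stable[of "gr_right_ideal \<Gamma> R C" W] assms(1)
    unfolding right_gr_artinian_def by metis
  let ?N = "max N1 N2"
  have "U m = U ?N" if m: "m \<ge> ?N" for m
  proof
    show "U m \<subseteq> U ?N" by (rule lift_Suc_antimono_le[of U, OF insert.prems(3) m])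
    show "U ?N \<subseteq> U m"
    proof
      fix x assume x: "x \<in> U ?N"
      then have xM: "x \<in> M" using UM by blast
      \<comment> \<open>\<open>W\<close> only records position \<open>(i, i)\<close>;
        \<open>column_shift\<close> brings the entry at \<open>(i, k)\<close> there.\<close>
      have "entry x i k \<in> W m" for k
      proof -
        have "entry x i k \<in> W ?N"
        proof (cases "k \<in> I")
          case True
          then show ?thesis
            using column_shift[OF ri i True i x u_in] u_right[OF entry_in[OF xM]] by (simp add: W_def)
        next
          case False
          then have "entry x i k = entry (0 :: ('i, 'a) fmat) i i" using entry_outside[OF xM] entry_zero by metis
          then show ?thesis using ri[of ?N] by (auto simp: W_def right_ideal_def add_subgroup_def)
        qed
        then show ?thesis using N2[of m] N2[of ?N] m by simp
      qed
      \<comment> \<open>\<open>w\<close> agrees with \<open>x\<close> in row \<open>i\<close>, so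
        \<open>x - w\<close> has row \<open>i\<close> zero and lies in
        \<open>V ?N = V m\<close>.\<close>
      then obtain w where w: "w \<in> U m" "\<And>k. entry w i k = entry x i k"
        using row_in_ideal[OF ri i i xM] unfolding W_def by blast
      have "w \<in> U ?N" using w lift_Suc_antimono_le[of U, OF insert.prems(3) m] by blast
      then have "x - w \<in> V ?N"
        using add_subgroup_diff[OF _ x] ri[of ?N] w(2) by (auto simp: V_def right_ideal_def entry_minus)
      then have "x - w \<in> U m" using N1[of m] N1[of ?N] m by (auto simp: V_def)
      then have "(x - w) + w \<in> U m"
        using add_subgroup_add[OF _ _ w(1)] ri[of m] unfolding right_ideal_def by blast
      then show "x \<in> U m" by simp
    qed
  qed
  then show ?case by blast
qed

text \<open>The identity is diagonal, with the identity of \<open>C (rg \<Gamma> s)\<close> in each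
  row \<open>i\<close> that has an \<open>s \<in> \<Sigma> i\<close> with
  \<open>dm \<Gamma> s = e\<close>. There are finitely many such rows, so this is a finitely
  supported matrix.\<close>

lemma ex_identity_MC:
  assumes e: "e \<in> Idm \<Gamma>"
  shows "\<exists>E. is_identity (MC e) E"
proof -
  have eM: "e \<in> Mor \<Gamma>" "dm \<Gamma> e = e" using e by (auto simp: Idm_def)
  then have rge: "rg \<Gamma> e = e" using category(4) by metis
  define F where "F = {i \<in> I. \<exists>s\<in>\<Sigma> i. dm \<Gamma> s = e}"
  have fin: "finite F" unfolding F_def by (rule finite_rows[OF e])
  obtain sg where sg: "\<And>i. i \<in> F \<Longrightarrow> sg i \<in> \<Sigma> i \<and> dm \<Gamma> (sg i) = e"
  proof -
    have "\<forall>i\<in>F. \<exists>s. s \<in> \<Sigma> i \<and> dm \<Gamma> s = e" by (auto simp: F_def)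
    then show thesis using that by (metis bchoice)
  qed
  have sg_eq: "sg i = s" if "i \<in> I" "s \<in> \<Sigma> i" "dm \<Gamma> s = e" for i s
    using that sg[of i] sigma_dm[of i "sg i" s] by (auto simp: F_def)
  define one where "one i = identity_of (C (rg \<Gamma> (sg i)))" for i
  define E where "E = Fmat (\<lambda>i j. if i = j \<and> i \<in> F then one i else 0)"
  have entry_E: "entry E i j = (if i = j \<and> i \<in> F then one i else 0)" for i j
    unfolding E_def by (subst entry_Fmat[of "(\<lambda>i. (i, i)) ` F"]) (auto simp: fin split: if_splits)
  have sgM: "sg i \<in> Mor \<Gamma>" if "i \<in> F" for i using sg[OF that] that sigma_Mor by (auto simp: F_def)
  have one_in: "one i \<in> C (rg \<Gamma> (sg i))" if "i \<in> F" for i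
    unfolding one_def using sgM[OF that] by (intro Idm_identity) (simp add: Idm_def category)
  \<comment> \<open>Degree \<open>e\<close> allows nonzero entries only in rows and columns of
    \<open>F\<close>, and their degrees run from \<open>rg \<Gamma> (sg j)\<close> to
    \<open>rg \<Gamma> (sg i)\<close>; hence \<open>one i\<close> and \<open>one j\<close> fix
    them.\<close>
  have conn_F: "i \<in> F \<and> j \<in> F \<and> d \<in> Mor \<Gamma> \<and> rg \<Gamma> d = rg \<Gamma> (sg i) \<and> dm \<Gamma> d = rg \<Gamma> (sg j)"
    if "i \<in> I" "j \<in> I" "conn i j e d" for i j d
  proof (rule connE[OF that(3,1,2)])
    fix s t assume st: "s \<in> \<Sigma> i" "t \<in> \<Sigma> j" "dm \<Gamma> s = rg \<Gamma> e" "dm \<Gamma> t = dm \<Gamma> e"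
      and d: "d \<in> Mor \<Gamma>" "rg \<Gamma> d = rg \<Gamma> s" "dm \<Gamma> d = rg \<Gamma> t"
    then have "dm \<Gamma> s = e" "dm \<Gamma> t = e" using eM rge by simp_all
    then show ?thesis
      using st d sg_eq[OF that(1) st(1)] sg_eq[OF that(2) st(2)] that(1,2) by (auto simp: F_def)
  qed
  have conn_diag: "conn i i e (rg \<Gamma> (sg i))" if "i \<in> F" for i
  proof -
    have "cmp \<Gamma> (cmp \<Gamma> (sg i) e) (inv_mor \<Gamma> (sg i)) = rg \<Gamma> (sg i)"
      using sg[OF that] category(7)[OF sgM[OF that]] inv_mor(5)[OF sgM[OF that]] by metis
    then show ?thesis unfolding conn_def using sg[OF that] eM rge by metis
  qed
  have "E \<in> MC e"
    unfolding mat_comp_iff[OF eM(1)]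
  proof (intro conjI ballI allI impI)
    have "one i \<in> R" if "i \<in> F" for i
      using one_in[OF that] comp_subset[of "rg \<Gamma> (sg i)"] category(2)[OF sgM[OF that]] by blast
    then show "E \<in> M"
      using add_subgroup_zero[OF subgroup] by (auto simp: mat_carrier_def entry_E F_def)
    fix i j assume ij: "i \<in> I" "j \<in> I"
    show "entry E i j \<in> C d" if d: "conn i j e d" for d
    proof (cases "i = j \<and> i \<in> F")
      case True
      then have "d = rg \<Gamma> (sg i)" using conn_unique[OF ij d] conn_diag by blast
      then show ?thesis using True one_in by (auto simp: entry_E)
    next
      case False
      then show ?thesis
        using add_subgroup_zero[OF comp_subgroup] conn_F[OF ij d] by (auto simp: entry_E)
    qed
    show "entry E i j = 0" if "\<forall>d. \<not> conn i j e d"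
      using that conn_diag by (auto simp: entry_E)
  qed
  moreover have "E * A = A \<and> A * E = A" if A: "A \<in> MC e" for A
  proof -
    have AM: "A \<in> M" using A by (simp add: mat_comp_def)
    have *: "i \<in> F \<and> j \<in> F \<and> one i * entry A i j = entry A i j \<and> entry A i j * one j = entry A i j"
      if nz: "entry A i j \<noteq> 0" for i j
    proof -
      have ij: "i \<in> I" "j \<in> I" using nz entry_outside[OF AM] by auto
      then obtain d where d: "conn i j e d" "entry A i j \<in> C d"
        using A nz unfolding mat_comp_iff[OF eM(1)] by blast
      then show ?thesis using conn_F[OF ij d(1)] identity_mult[of d "entry A i j"] by (simp add: one_def)
    qed
    have "entry (E * A) i j = entry A i j" for i j
    proof -
      have "entry (E * A) i j = (\<Sum>k\<in>{i}. entry E i k * entry A k j)"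
        by (rule entry_times_superset) (auto simp: entry_E split: if_splits)
      then show ?thesis using *[of i j] by (cases "entry A i j = 0") (auto simp: entry_E)
    qed
    moreover have "entry (A * E) i j = entry A i j" for i j
    proof -
      have "entry (A * E) i j = (\<Sum>k\<in>{j}. entry A i k * entry E k j)"
        by (rule entry_times_superset) (auto simp: entry_E split: if_splits)
      then show ?thesis using *[of i j] by (cases "entry A i j = 0") (auto simp: entry_E)
    qed
    ultimately show ?thesis by (auto intro: fmat_eqI)
  qed
  ultimately show ?thesis unfolding is_identity_def by blast
qed

text \<open>Row \<open>i\<close> of the identity vanishes because no degree is linked to
  \<open>e\<close> in that row. This confines the elements of \<open>1\<^sub>e M\<close> to finitely
  many rows.\<close>

lemma identity_MC_row:
  assumes e: "e \<in> Idm \<Gamma>" and i: "\<not> (i \<in> I \<and> (\<exists>s\<in>\<Sigma> i. dm \<Gamma> s = e))"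
  shows "entry (identity_of (MC e) * A) i j = 0"
proof -
  have eM: "e \<in> Mor \<Gamma>" "dm \<Gamma> e = e" using e by (auto simp: Idm_def)
  then have rge: "rg \<Gamma> e = e" using category(4) by metis
  obtain v where v: "is_identity (MC e) v" using ex_identity_MC[OF e] by blast
  have "w = v" if "is_identity (MC e) w" for w using v that unfolding is_identity_def by metis
  then have "is_identity (MC e) (identity_of (MC e))"
    unfolding identity_of_def using v by (rule theI[rotated])
  then have E: "identity_of (MC e) \<in> MC e" by (simp add: is_identity_def)
  have "entry (identity_of (MC e)) i k = 0" for k
  proof (cases "i \<in> I \<and> k \<in> I")
    case True
    then have "\<not> conn i k e d" for d using i rge unfolding conn_def by auto
    then show ?thesis using E True unfolding mat_comp_iff[OF eM(1)] by blast
  next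
    case False
    then show ?thesis using E by (auto simp: mat_comp_def mat_carrier_def)
  qed
  then show ?thesis by (simp add: entry_times)
qed

lemma right_\<Gamma>0_artinian_M:
  assumes "right_gr_artinian \<Gamma> R C"
  shows "right_\<Gamma>0_artinian \<Gamma> M MC"
  unfolding right_\<Gamma>0_artinian_def
proof (intro ballI notI)
  fix e assume e: "e \<in> Idm \<Gamma>"
  assume "\<exists>U :: nat \<Rightarrow> _. \<forall>n. gr_right_ideal \<Gamma> M MC (U n) \<and>
       U n \<subseteq> {identity_of (MC e) * s | s. s \<in> M} \<and> U (Suc n) \<subset> U n"
  then obtain U :: "nat \<Rightarrow> _" where U: "\<And>n. gr_right_ideal \<Gamma> M MC (U n)"
    "\<And>n. U n \<subseteq> {identity_of (MC e) * s | s. s \<in> M}" "\<And>n. U (Suc n) \<subset> U n" by blast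
  have "\<exists>N. \<forall>m\<ge>N. U m = U N"
  proof (rule stable_finite_rows[OF assms finite_rows[OF e]])
    show "entry A i j = 0" if "A \<in> U n" "i \<notin> {i \<in> I. \<exists>s\<in>\<Sigma> i. dm \<Gamma> s = e}" for n A i j
      using that U(2)[of n] identity_MC_row[OF e, of i] by auto
    show "U (Suc n) \<subseteq> U n" for n using U(3)[of n] by blast
  qed (use U(1) in auto)
  then obtain N where "U (Suc N) = U N" by (metis le_SucI order_refl)
  then show False using U(3)[of N] by blast
qed

text \<open>If \<open>V\<close> is strictly larger, its entries at \<open>(i, i)\<close> form a
  graded right ideal strictly above \<open>m\<close>, hence all of \<open>R\<close>. So
  \<open>V\<close> realises row \<open>i\<close> of any \<open>s\<close>, and the remaining
  difference has row \<open>i\<close> zero and lies in \<open>?m \<subseteq> V\<close>.\<close>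

lemma gr_maximal_row:
  assumes m: "gr_maximal \<Gamma> R C m" and i: "i \<in> I"
  shows "gr_maximal \<Gamma> M MC {A \<in> M. \<forall>j. entry A i j \<in> m}" (is "gr_maximal _ _ _ ?m")
proof -
  have gr: "gr_right_ideal \<Gamma> R C m" and ne: "m \<noteq> R"
    and max: "\<And>V. gr_right_ideal \<Gamma> R C V \<Longrightarrow> V \<noteq> R \<Longrightarrow> m \<subseteq> V \<Longrightarrow> V = m"
    using m by (auto simp: gr_maximal_def)
  have ri: "right_ideal R m" and sub: "add_subgroup m" and mR: "m \<subseteq> R"
    using gr by (auto simp: gr_right_ideal_def right_ideal_def)
  have "right_ideal M ?m"
    unfolding right_ideal_def
  proof (intro conjI ballI)
    show "add_subgroup ?m"
      using sub add_subgroup_M by (auto simp: add_subgroup_def entry_zero entry_plus entry_uminus)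
    show "A * B \<in> ?m" if "A \<in> ?m" "B \<in> M" for A B
      using that M_mult_closed mult_entry_closed[OF ri] by auto
  qed auto
  moreover have "hpart (Mor \<Gamma>) MC A g \<in> ?m" if A: "A \<in> ?m" and g: "g \<in> Mor \<Gamma>" for A g
  proof -
    have "hpart (Mor \<Gamma>) MC A g \<in> M" using A g M.hpart_in M.comp_subset by blast
    moreover have "deg_part (entry A i j) i j g \<in> m" for j
      using A gr by (intro deg_part_closed[OF sub]) (auto simp: gr_right_ideal_iff_part)
    ultimately show ?thesis using A entry_hpart by simp
  qed
  ultimately have grm: "gr_right_ideal \<Gamma> M MC ?m" unfolding gr_right_ideal_M_iff by blast
  obtain r where r: "r \<in> R" "r \<notin> m" using ne mR by blast
  have "munit r i i \<in> M - ?m" using r i munit_in_M by (auto simp: entry_munit split: if_splits)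
  then have "?m \<noteq> M" by blast
  moreover have "V = ?m" if grV: "gr_right_ideal \<Gamma> M MC V" and V: "V \<noteq> M" "?m \<subseteq> V" for V
  proof (rule ccontr)
    assume "V \<noteq> ?m"
    have riV: "right_ideal M V" and VM: "V \<subseteq> M" and subV: "add_subgroup V"
      using grV by (auto simp: gr_right_ideal_def right_ideal_def)
    let ?P = "(\<lambda>v. entry v i i) ` V"
    have grP: "gr_right_ideal \<Gamma> R C ?P" by (rule gr_right_ideal_column[OF grV i i])
    have "m \<subseteq> ?P"
    proof
      fix x assume x: "x \<in> m"
      then have "munit x i i \<in> ?m"
        using munit_in_M[OF _ i i] mR add_subgroup_zero[OF sub] by (auto simp: entry_munit)
      then have "munit x i i \<in> V" using V by blast
      then show "x \<in> ?P" by (rule image_eqI[rotated]) (simp add: entry_munit)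
    qed
    moreover have "?P \<noteq> m"
    proof -
      obtain v j where v: "v \<in> V" "entry v i j \<notin> m" using \<open>V \<noteq> ?m\<close> V VM by blast
      have vM: "v \<in> M" using v VM by blast
      have "j \<in> I" using v(2) entry_outside[OF vM] add_subgroup_zero[OF sub] by metis
      \<comment> \<open>An entry outside \<open>m\<close> may sit in any column; it is moved to
        \<open>(i, i)\<close>.\<close>
      then have "entry v i j \<in> ?P"
        using column_shift[OF riV i _ i v(1) u_in] u_right[OF entry_in[OF vM]] by metis
      then show ?thesis using v by blast
    qed
    ultimately have P: "?P = R" using max[OF grP] by blast
    have "s \<in> V" if s: "s \<in> M" for s
    proof -
      obtain w where w: "w \<in> V" "\<And>k. entry w i k = entry s i k"
        using row_in_ideal[OF riV i i s] P entry_in[OF s] by metis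
      have "s - w \<in> M" using add_subgroup_diff[OF add_subgroup_M s] w(1) VM by blast
      then have "s - w \<in> V" using V(2) w(2) add_subgroup_zero[OF sub] by (auto simp: entry_minus)
      then have "(s - w) + w \<in> V" using add_subgroup_add[OF subV] w(1) by blast
      then show ?thesis by simp
    qed
    then show False using V VM by blast
  qed
  ultimately show ?thesis using grm unfolding gr_maximal_def by blast
qed

lemma entry_rad:
  assumes A: "A \<in> rad_gr \<Gamma> M MC"
  shows "entry A i j \<in> rad_gr \<Gamma> R C"
proof (cases "i \<in> I")
  case True
  have "entry A i j \<in> m" if "gr_maximal \<Gamma> R C m" for m
    using A gr_maximal_row[OF that True] unfolding rad_gr_def by blast
  then show ?thesis using A entry_in by (auto simp: rad_gr_def)
next
  case False
  then have "entry A i j = 0" using A entry_outside by (auto simp: rad_gr_def)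
  then show ?thesis
    using gr_right_ideal_rad by (auto simp: gr_right_ideal_def right_ideal_def add_subgroup_def)
qed

text \<open>Matrices with entries in a power of \<open>V\<close> form an additive subgroup, and
  entries of a product of two matrices are sums of products of entries.\<close>

lemma entry_ideal_pow:
  assumes "add_subgroup V" "\<And>A i j. A \<in> U \<Longrightarrow> entry A i j \<in> V"
  shows "A \<in> ideal_pow_Suc U n \<Longrightarrow> entry A i j \<in> ideal_pow_Suc V n"
proof (induction n arbitrary: A i j)
  case 0
  then show ?case using assms by simp
next
  case (Suc n)
  have "ideal_prod (ideal_pow_Suc U n) U \<subseteq> {A. \<forall>i j. entry A i j \<in> ideal_pow_Suc V (Suc n)}"
  proof (rule ideal_prod_subsetI)
    show "add_subgroup {A. \<forall>i j. entry A i j \<in> ideal_pow_Suc V (Suc n)}"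
      using add_subgroup_ideal_prod[of "ideal_pow_Suc V n" V]
      by (auto simp: add_subgroup_def entry_zero entry_plus entry_uminus)
    fix A B assume "A \<in> ideal_pow_Suc U n" "B \<in> U"
    then have "entry (A * B) i j \<in> ideal_pow_Suc V (Suc n)" for i j
      unfolding entry_times ideal_pow_Suc.simps
      using Suc.IH assms(2) by (intro add_subgroup_sum add_subgroup_ideal_prod mult_in_ideal_prod)
    then show "A * B \<in> {A. \<forall>i j. entry A i j \<in> ideal_pow_Suc V (Suc n)}" by blast
  qed
  then show ?case using Suc.prems by auto
qed

lemma nilpotent_rad_M:
  assumes "right_gr_artinian \<Gamma> R C"
  shows "nilpotent (rad_gr \<Gamma> M MC)"
proof -
  let ?J = "rad_gr \<Gamma> M MC" and ?N = "rad_gr \<Gamma> R C"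
  obtain n where n: "ideal_pow_Suc ?N n = {0}" using rad_nilpotent[OF assms] .
  have subN: "add_subgroup ?N"
    using gr_right_ideal_rad by (simp add: gr_right_ideal_def right_ideal_def)
  have "A = 0" if "A \<in> ideal_pow_Suc ?J n" for A
    using entry_ideal_pow[OF subN entry_rad that] n by (intro fmat_eqI) (simp add: entry_zero)
  \<comment> \<open>\<open>nilpotent\<close> asks for equality with \<open>{0}\<close>, so zero must
    also be a member. Index \<open>0\<close> means the radical itself, not an ideal product, and is
    treated separately.\<close>
  moreover have "0 \<in> ideal_pow_Suc ?J n"
  proof (cases n)
    case 0
    then show ?thesis
      using add_subgroup_zero[OF add_subgroup_M]
      by (auto simp: rad_gr_def gr_maximal_def gr_right_ideal_def right_ideal_def add_subgroup_def)
  next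
    case (Suc k)
    then show ?thesis using add_subgroup_zero[OF add_subgroup_ideal_prod] by simp
  qed
  ultimately show ?thesis unfolding nilpotent_def by blast
qed

end

theorem corollary7p5:
  fixes \<Gamma> :: "('g, 'm) small_cat_scheme"
    and R :: "'a::ring set"
    and C :: "'g \<Rightarrow> 'a set"
    and I :: "'i set"
    and \<Sigma> :: "'i \<Rightarrow> 'g set"
  assumes "groupoid \<Gamma>"
    and "graded_ring \<Gamma> R C"
    and "unital R"
    and "fully_matricial \<Gamma> C I \<Sigma>"
    and "right_gr_artinian \<Gamma> R C"
  shows "right_\<Gamma>0_artinian \<Gamma> (mat_carrier R I) (mat_comp \<Gamma> R C I \<Sigma>) \<and>
         nilpotent (rad_gr \<Gamma> (mat_carrier R I) (mat_comp \<Gamma> R C I \<Sigma>))"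
proof -
  obtain u where "is_identity R u" using assms(3) unfolding unital_def by blast
  then interpret graded_matrix_ring \<Gamma> R C u I \<Sigma> using assms by unfold_locales
  show ?thesis using right_\<Gamma>0_artinian_M nilpotent_rad_M assms(5) by blast
qed

end
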